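(* Let $\mathcal{B}$ be a pivotal bicategory. Then orbifold equivalence of objects of $\mathcal{B}$ is an equivalence relation.
   Context: In a bicategory $\mathcal{B}$, write $I_a$ for the unit 1-morphism of $a$, $Y\otimes X\in\mathcal{B}(a,c)$ for the composite of $X\in\mathcal{B}(a,b)$, $Y\in\mathcal{B}(b,c)$, and $\lambda,\rho$ for left and right unitors. $\mathcal{B}$ has left adjoints if every $X\in\mathcal{B}(a,b)$ has $X^\dagger\in\mathcal{B}(b,a)$ with 2-morphisms $\mathrm{ev}_X:X^\dagger\otimes X\to I_a$, $\mathrm{coev}_X:I_b\to X\otimes X^\dagger$ forming the counit and unit of an adjunction. It is pivotal if moreover there are natural isomorphisms $\delta^{a,b}:\mathrm{Id}\Rightarrow(-)^{\dagger\dagger}$ on each $\mathcal{B}(a,b)$, compatible with $\otimes$; then $\widetilde{\mathrm{ev}}_X=\mathrm{ev}_{X^\dagger}\circ(\delta_X\otimes1_{X^\dagger}):X\otimes X^\dagger\to I_b$ and $\widetilde{\mathrm{coev}}_X=(1_{X^\dagger}\otimes\delta_X^{-1})\circ\mathrm{coev}_{X^\dagger}:I_a\to X^\dagger\otimes X$. Define $\mathcal{D}_{\mathrm{l}}(X):\operatorname{End}(I_b)\to\operatorname{End}(I_a)$, $\varphi\mapsto\mathrm{ev}_X\circ[1_{X^\dagger}\otimes(\lambda_X\circ(\varphi\otimes1_X)\circ\lambda_X^{-1})]\circ\widetilde{\mathrm{coev}}_X$, and $\mathcal{D}_{\mathrm{r}}(X):\operatorname{End}(I_a)\to\operatorname{End}(I_b)$,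 $\psi\mapsto\widetilde{\mathrm{ev}}_X\circ[(\rho_X\circ(1_X\otimes\psi)\circ\rho_X^{-1})\otimes1_{X^\dagger}]\circ\mathrm{coev}_X$. The left and right quantum dimensions are $\dim_{\mathrm{l}}(X)=\mathcal{D}_{\mathrm{l}}(X)(1_{I_b})=\mathrm{ev}_X\circ\widetilde{\mathrm{coev}}_X$ and $\dim_{\mathrm{r}}(X)=\mathcal{D}_{\mathrm{r}}(X)(1_{I_a})=\widetilde{\mathrm{ev}}_X\circ\mathrm{coev}_X$. Objects $a,b$ are orbifold equivalent, $a\sim b$, if there is $X\in\mathcal{B}(a,b)$ such that (i) $\dim_{\mathrm{l}}(X)$ and $\dim_{\mathrm{r}}(X)$ are invertible, and (ii) $\mathcal{D}_{\mathrm{r}}(X)$ maps every invertible element of $\operatorname{End}(I_a)$ that is a (left or right) quantum dimension of some 1-morphism to an invertible element of $\operatorname{End}(I_b)$, and $\mathcal{D}_{\mathrm{l}}(X)$ maps every invertible element of $\operatorname{End}(I_b)$ that is a quantum dimension of some 1-morphism to an invertible element of $\operatorname{End}(I_a)$. *)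

theory Defs
  imports Main
begin

text \<open>A bicategory presented by carriers: objects, 1-morphisms (with source and
target), 2-morphisms (with domain and codomain 1-morphism).
  hcomp B Y X is the composite Y (x) X of X : a -> b and Y : b -> c;
  vcomp B g f is vertical composite g o f;
  assoc B Z Y X : (Z (x) Y) (x) X => Z (x) (Y (x) X);
  lunit B X : I_b (x) X => X;   runit B X : X (x) I_a => X   (X : a -> b).
The same record also carries the chosen left adjoints X^dagger (dag), ev, coev
and the pivotal structure delta (piv).\<close>

record ('o, 'm, 'c) pbicat =
  Obj :: "'o set"
  Mor :: "'m set"
  Cell :: "'c set"
  src :: "'m \<Rightarrow> 'o"
  trg :: "'m \<Rightarrow> 'o"
  dom2 :: "'c \<Rightarrow> 'm"
  cod2 :: "'c \<Rightarrow> 'm"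
  vcomp :: "'c \<Rightarrow> 'c \<Rightarrow> 'c"
  id2 :: "'m \<Rightarrow> 'c"
  hcomp :: "'m \<Rightarrow> 'm \<Rightarrow> 'm"
  hcomp2 :: "'c \<Rightarrow> 'c \<Rightarrow> 'c"
  unit1 :: "'o \<Rightarrow> 'm"
  assoc :: "'m \<Rightarrow> 'm \<Rightarrow> 'm \<Rightarrow> 'c"
  lunit :: "'m \<Rightarrow> 'c"
  runit :: "'m \<Rightarrow> 'c"
  dag :: "'m \<Rightarrow> 'm"
  ev :: "'m \<Rightarrow> 'c"
  coev :: "'m \<Rightarrow> 'c"
  piv :: "'m \<Rightarrow> 'c"

type_synonym ('o, 'm, 'c) PB = "('o, 'm, 'c) pbicat"

definition hom :: "('o,'m,'c) PB \<Rightarrow> 'o \<Rightarrow> 'o \<Rightarrow> 'm set" where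
  "hom B a b = {X \<in> Mor B. src B X = a \<and> trg B X = b}"

definition hom2 :: "('o,'m,'c) PB \<Rightarrow> 'm \<Rightarrow> 'm \<Rightarrow> 'c set" where
  "hom2 B X Y = {f \<in> Cell B. dom2 B f = X \<and> cod2 B f = Y}"

definition End :: "('o,'m,'c) PB \<Rightarrow> 'o \<Rightarrow> 'c set" where
  "End B a = hom2 B (unit1 B a) (unit1 B a)"

definition iso2 :: "('o,'m,'c) PB \<Rightarrow> 'c \<Rightarrow> bool" where
  "iso2 B f \<longleftrightarrow> f \<in> Cell B \<and>
     (\<exists>g \<in> hom2 B (cod2 B f) (dom2 B f).
        vcomp B g f = id2 B (dom2 B f) \<and> vcomp B f g = id2 B (cod2 B f))"

definition inv2 :: "('o,'m,'c) PB \<Rightarrow> 'c \<Rightarrow> 'c" where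
  "inv2 B f = (SOME g. g \<in> hom2 B (cod2 B f) (dom2 B f) \<and>
        vcomp B g f = id2 B (dom2 B f) \<and> vcomp B f g = id2 B (cod2 B f))"

fun vcs :: "('o,'m,'c) PB \<Rightarrow> 'c list \<Rightarrow> 'c" where
  "vcs B [] = undefined"
| "vcs B [f] = f"
| "vcs B (f # g # fs) = vcomp B f (vcs B (g # fs))"

definition bicategory :: "('o,'m,'c) PB \<Rightarrow> bool" where
  "bicategory B \<longleftrightarrow>
    (\<forall>X \<in> Mor B. src B X \<in> Obj B \<and> trg B X \<in> Obj B)
  \<and> (\<forall>f \<in> Cell B. dom2 B f \<in> Mor B \<and> cod2 B f \<in> Mor B
        \<and> src B (dom2 B f) = src B (cod2 B f) \<and> trg B (dom2 B f) = trg B (cod2 B f))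
  \<comment> \<open>vertical composition: each hom-category is a category\<close>
  \<and> (\<forall>X \<in> Mor B. id2 B X \<in> hom2 B X X)
  \<and> (\<forall>f \<in> Cell B. \<forall>g \<in> Cell B. cod2 B f = dom2 B g \<longrightarrow>
        vcomp B g f \<in> hom2 B (dom2 B f) (cod2 B g))
  \<and> (\<forall>f \<in> Cell B. \<forall>g \<in> Cell B. \<forall>h \<in> Cell B.
        cod2 B f = dom2 B g \<longrightarrow> cod2 B g = dom2 B h \<longrightarrow>
        vcomp B h (vcomp B g f) = vcomp B (vcomp B h g) f)
  \<and> (\<forall>f \<in> Cell B. vcomp B (id2 B (cod2 B f)) f = f \<and> vcomp B f (id2 B (dom2 B f)) = f)
  \<comment> \<open>horizontal composition is a functor\<close>
  \<and> (\<forall>X \<in> Mor B. \<forall>Y \<in> Mor B. src B Y = trg B X \<longrightarrow>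
        hcomp B Y X \<in> hom B (src B X) (trg B Y))
  \<and> (\<forall>f \<in> Cell B. \<forall>g \<in> Cell B. src B (dom2 B g) = trg B (dom2 B f) \<longrightarrow>
        hcomp2 B g f \<in> hom2 B (hcomp B (dom2 B g) (dom2 B f)) (hcomp B (cod2 B g) (cod2 B f)))
  \<and> (\<forall>X \<in> Mor B. \<forall>Y \<in> Mor B. src B Y = trg B X \<longrightarrow>
        hcomp2 B (id2 B Y) (id2 B X) = id2 B (hcomp B Y X))
  \<and> (\<forall>f \<in> Cell B. \<forall>f' \<in> Cell B. \<forall>g \<in> Cell B. \<forall>g' \<in> Cell B.
        cod2 B f = dom2 B f' \<longrightarrow> cod2 B g = dom2 B g' \<longrightarrow>
        src B (dom2 B g) = trg B (dom2 B f) \<longrightarrow>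
        hcomp2 B (vcomp B g' g) (vcomp B f' f) = vcomp B (hcomp2 B g' f') (hcomp2 B g f))
  \<comment> \<open>units\<close>
  \<and> (\<forall>a \<in> Obj B. unit1 B a \<in> hom B a a)
  \<comment> \<open>associator: invertible and natural\<close>
  \<and> (\<forall>X \<in> Mor B. \<forall>Y \<in> Mor B. \<forall>Z \<in> Mor B. src B Z = trg B Y \<longrightarrow> src B Y = trg B X \<longrightarrow>
        assoc B Z Y X \<in> hom2 B (hcomp B (hcomp B Z Y) X) (hcomp B Z (hcomp B Y X))
        \<and> iso2 B (assoc B Z Y X))
  \<and> (\<forall>f \<in> Cell B. \<forall>g \<in> Cell B. \<forall>h \<in> Cell B.
        src B (dom2 B h) = trg B (dom2 B g) \<longrightarrow> src B (dom2 B g) = trg B (dom2 B f) \<longrightarrow>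
        vcomp B (assoc B (cod2 B h) (cod2 B g) (cod2 B f)) (hcomp2 B (hcomp2 B h g) f)
        = vcomp B (hcomp2 B h (hcomp2 B g f)) (assoc B (dom2 B h) (dom2 B g) (dom2 B f)))
  \<comment> \<open>unitors: invertible and natural\<close>
  \<and> (\<forall>X \<in> Mor B. lunit B X \<in> hom2 B (hcomp B (unit1 B (trg B X)) X) X \<and> iso2 B (lunit B X))
  \<and> (\<forall>X \<in> Mor B. runit B X \<in> hom2 B (hcomp B X (unit1 B (src B X))) X \<and> iso2 B (runit B X))
  \<and> (\<forall>f \<in> Cell B.
        vcomp B (lunit B (cod2 B f)) (hcomp2 B (id2 B (unit1 B (trg B (dom2 B f)))) f)
        = vcomp B f (lunit B (dom2 B f)))
  \<and> (\<forall>f \<in> Cell B.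
        vcomp B (runit B (cod2 B f)) (hcomp2 B f (id2 B (unit1 B (src B (dom2 B f)))))
        = vcomp B f (runit B (dom2 B f)))
  \<comment> \<open>pentagon\<close>
  \<and> (\<forall>X \<in> Mor B. \<forall>Y \<in> Mor B. \<forall>Z \<in> Mor B. \<forall>W \<in> Mor B.
        src B W = trg B Z \<longrightarrow> src B Z = trg B Y \<longrightarrow> src B Y = trg B X \<longrightarrow>
        vcs B [hcomp2 B (id2 B W) (assoc B Z Y X),
               assoc B W (hcomp B Z Y) X,
               hcomp2 B (assoc B W Z Y) (id2 B X)]
        = vcomp B (assoc B W Z (hcomp B Y X)) (assoc B (hcomp B W Z) Y X))
  \<comment> \<open>triangle\<close>
  \<and> (\<forall>X \<in> Mor B. \<forall>Y \<in> Mor B. src B Y = trg B X \<longrightarrow>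
        vcomp B (hcomp2 B (id2 B Y) (lunit B X)) (assoc B Y (unit1 B (trg B X)) X)
        = hcomp2 B (runit B Y) (id2 B X))"

definition has_left_adjoints :: "('o,'m,'c) PB \<Rightarrow> bool" where
  "has_left_adjoints B \<longleftrightarrow>
    (\<forall>X \<in> Mor B.
        dag B X \<in> hom B (trg B X) (src B X)
      \<and> ev B X \<in> hom2 B (hcomp B (dag B X) X) (unit1 B (src B X))
      \<and> coev B X \<in> hom2 B (unit1 B (trg B X)) (hcomp B X (dag B X))
      \<and> vcs B [runit B X,
               hcomp2 B (id2 B X) (ev B X),
               assoc B X (dag B X) X,
               hcomp2 B (coev B X) (id2 B X),
               inv2 B (lunit B X)] = id2 B X
      \<and> vcs B [lunit B (dag B X),
               hcomp2 B (ev B X) (id2 B (dag B X)),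
               inv2 B (assoc B (dag B X) X (dag B X)),
               hcomp2 B (id2 B (dag B X)) (coev B X),
               inv2 B (runit B (dag B X))] = id2 B (dag B X))"

definition mate :: "('o,'m,'c) PB \<Rightarrow> 'c \<Rightarrow> 'c" where
  "mate B f = (let X = dom2 B f; Y = cod2 B f in
     vcs B [lunit B (dag B X),
            hcomp2 B (ev B Y) (id2 B (dag B X)),
            inv2 B (assoc B (dag B Y) Y (dag B X)),
            hcomp2 B (id2 B (dag B Y)) (vcomp B (hcomp2 B f (id2 B (dag B X))) (coev B X)),
            inv2 B (runit B (dag B Y))])"

text \<open>Evaluation exhibiting dag X (x) dag Y as left adjoint of Y (x) X, and the
  resulting canonical isomorphism dag X (x) dag Y => dag (Y (x) X).\<close>
definition ev_comp :: "('o,'m,'c) PB \<Rightarrow> 'm \<Rightarrow> 'm \<Rightarrow> 'c" where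
  "ev_comp B Y X =
     vcs B [ev B X,
            hcomp2 B (id2 B (dag B X)) (lunit B X),
            hcomp2 B (id2 B (dag B X)) (hcomp2 B (ev B Y) (id2 B X)),
            hcomp2 B (id2 B (dag B X)) (inv2 B (assoc B (dag B Y) Y X)),
            assoc B (dag B X) (dag B Y) (hcomp B Y X)]"

definition dag_comp_iso :: "('o,'m,'c) PB \<Rightarrow> 'm \<Rightarrow> 'm \<Rightarrow> 'c" where
  "dag_comp_iso B Y X = (let Z = hcomp B Y X; W = hcomp B (dag B X) (dag B Y) in
     vcs B [lunit B (dag B Z),
            hcomp2 B (ev_comp B Y X) (id2 B (dag B Z)),
            inv2 B (assoc B W Z (dag B Z)),
            hcomp2 B (id2 B W) (coev B Z),
            inv2 B (runit B W)])"

text \<open>Monoidal structure of the double dual: dag dag Y (x) dag dag X => dag dag (Y (x) X).\<close>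
definition ddag_comp_iso :: "('o,'m,'c) PB \<Rightarrow> 'm \<Rightarrow> 'm \<Rightarrow> 'c" where
  "ddag_comp_iso B Y X =
     vcomp B (mate B (inv2 B (dag_comp_iso B Y X))) (dag_comp_iso B (dag B X) (dag B Y))"

definition pivotal_structure :: "('o,'m,'c) PB \<Rightarrow> bool" where
  "pivotal_structure B \<longleftrightarrow>
    (\<forall>X \<in> Mor B. piv B X \<in> hom2 B X (dag B (dag B X)) \<and> iso2 B (piv B X))
  \<and> (\<forall>f \<in> Cell B. vcomp B (piv B (cod2 B f)) f = vcomp B (mate B (mate B f)) (piv B (dom2 B f)))
  \<and> (\<forall>X \<in> Mor B. \<forall>Y \<in> Mor B. src B Y = trg B X \<longrightarrow>
        piv B (hcomp B Y X) = vcomp B (ddag_comp_iso B Y X) (hcomp2 B (piv B Y) (piv B X)))"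

definition pivotal_bicategory :: "('o,'m,'c) PB \<Rightarrow> bool" where
  "pivotal_bicategory B \<longleftrightarrow> bicategory B \<and> has_left_adjoints B \<and> pivotal_structure B"

definition ev_tilde :: "('o,'m,'c) PB \<Rightarrow> 'm \<Rightarrow> 'c" where
  "ev_tilde B X = vcomp B (ev B (dag B X)) (hcomp2 B (piv B X) (id2 B (dag B X)))"

definition coev_tilde :: "('o,'m,'c) PB \<Rightarrow> 'm \<Rightarrow> 'c" where
  "coev_tilde B X = vcomp B (hcomp2 B (id2 B (dag B X)) (inv2 B (piv B X))) (coev B (dag B X))"

definition D_l :: "('o,'m,'c) PB \<Rightarrow> 'm \<Rightarrow> 'c \<Rightarrow> 'c" where
  "D_l B X \<phi> = vcs B [ev B X,
       hcomp2 B (id2 B (dag B X))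
          (vcs B [lunit B X, hcomp2 B \<phi> (id2 B X), inv2 B (lunit B X)]),
       coev_tilde B X]"

definition D_r :: "('o,'m,'c) PB \<Rightarrow> 'm \<Rightarrow> 'c \<Rightarrow> 'c" where
  "D_r B X \<psi> = vcs B [ev_tilde B X,
       hcomp2 B (vcs B [runit B X, hcomp2 B (id2 B X) \<psi>, inv2 B (runit B X)])
          (id2 B (dag B X)),
       coev B X]"

definition dim_l :: "('o,'m,'c) PB \<Rightarrow> 'm \<Rightarrow> 'c" where
  "dim_l B X = vcomp B (ev B X) (coev_tilde B X)"

definition dim_r :: "('o,'m,'c) PB \<Rightarrow> 'm \<Rightarrow> 'c" where
  "dim_r B X = vcomp B (ev_tilde B X) (coev B X)"

definition is_qdim :: "('o,'m,'c) PB \<Rightarrow> 'c \<Rightarrow> bool" where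
  "is_qdim B f \<longleftrightarrow> (\<exists>Z \<in> Mor B. f = dim_l B Z \<or> f = dim_r B Z)"

definition orbifold_equivalent :: "('o,'m,'c) PB \<Rightarrow> 'o \<Rightarrow> 'o \<Rightarrow> bool" where
  "orbifold_equivalent B a b \<longleftrightarrow> a \<in> Obj B \<and> b \<in> Obj B \<and>
    (\<exists>X \<in> hom B a b.
        iso2 B (dim_l B X) \<and> iso2 B (dim_r B X)
      \<and> (\<forall>\<psi> \<in> End B a. iso2 B \<psi> \<and> is_qdim B \<psi> \<longrightarrow> iso2 B (D_r B X \<psi>))
      \<and> (\<forall>\<phi> \<in> End B b. iso2 B \<phi> \<and> is_qdim B \<phi> \<longrightarrow> iso2 B (D_l B X \<phi>)))"

end

theory Submission
  imports Defs
begin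

text \<open>A 2-morphism \<open>f : X \<Rightarrow> Y\<close> is determined by the whiskered cells \<open>f \<otimes> 1\<^sub>U\<close>, so 1-morphisms may be
  replaced by the functors \<open>X \<otimes> -\<close> and 2-morphisms by natural transformations between them.
  Bracketing everything to the right, a cell \<open>W \<otimes> Z \<Rightarrow> I\<close> acts as \<open>W \<otimes> (Z \<otimes> U) \<Rightarrow> U\<close> and the
  calculus of adjunctions becomes strict: only vertical composition, left whiskering and naturality occur.

  In this calculus the compatibility of the pivotal structure with \<open>\<otimes>\<close> gives
  \<open>D\<^sub>r(Y \<otimes> X) = D\<^sub>r(Y) \<circ> D\<^sub>r(X)\<close>, and its naturality shows that \<open>D\<^sub>r(X)\<close> depends on \<open>X\<close> only up to
  isomorphism. Compatibility with \<open>I \<otimes> I\<close> forces \<open>D\<^sub>r(I) = id\<close>, and naturality at \<open>ev\<^sub>X\<close> then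
  gives \<open>D\<^sub>l(X) = D\<^sub>r(X\<^sup>\<dagger>)\<close>. Hence quantum dimensions are exactly the \<open>D\<^sub>r(Z)(1)\<close>, they are stable
  under every \<open>D\<^sub>r(X)\<close>, and the witnesses \<open>I\<close>, \<open>X\<^sup>\<dagger>\<close>, \<open>Y \<otimes> X\<close> prove reflexivity, symmetry and
  transitivity.\<close>

locale bicat =
  fixes B :: "('o, 'm, 'c) pbicat"
  assumes bicategory: "bicategory B"
begin

abbreviation vc (infixr "\<cdot>" 55) where "g \<cdot> f \<equiv> vcomp B g f"
abbreviation hc (infixr "\<otimes>" 65) where "Y \<otimes> X \<equiv> hcomp B Y X"
abbreviation "I \<equiv> unit1 B"
abbreviation "ass \<equiv> assoc B"
abbreviation "ass' Z Y X \<equiv> inv2 B (assoc B Z Y X)"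
abbreviation "lu \<equiv> lunit B"
abbreviation "lu' X \<equiv> inv2 B (lunit B X)"
abbreviation "ru \<equiv> runit B"
abbreviation "ru' X \<equiv> inv2 B (runit B X)"

definition lwh (infixr "\<lhd>" 60) where "W \<lhd> g = hcomp2 B (id2 B W) g"
definition rwh (infixl "\<rhd>" 61) where "f \<rhd> U = hcomp2 B f (id2 B U)"

subsection \<open>Typing\<close>

lemmas ax1 = bicategory[unfolded bicategory_def]
lemmas ax2 = ax1[THEN conjunct2]
lemmas ax3 = ax2[THEN conjunct2]
lemmas ax4 = ax3[THEN conjunct2]
lemmas ax5 = ax4[THEN conjunct2]
lemmas ax6 = ax5[THEN conjunct2]
lemmas ax7 = ax6[THEN conjunct2]
lemmas ax8 = ax7[THEN conjunct2]
lemmas ax9 = ax8[THEN conjunct2]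
lemmas ax10 = ax9[THEN conjunct2]
lemmas ax11 = ax10[THEN conjunct2]
lemmas ax12 = ax11[THEN conjunct2]
lemmas ax13 = ax12[THEN conjunct2]
lemmas ax14 = ax13[THEN conjunct2]
lemmas ax15 = ax14[THEN conjunct2]
lemmas ax16 = ax15[THEN conjunct2]
lemmas ax17 = ax16[THEN conjunct2]
lemmas ax18 = ax17[THEN conjunct2]
lemmas ax19 = ax18[THEN conjunct2]

lemma mor_obj [simp]:
  "X \<in> Mor B \<Longrightarrow> src B X \<in> Obj B" "X \<in> Mor B \<Longrightarrow> trg B X \<in> Obj B"
  using ax1[THEN conjunct1] by (auto)

lemma cell_mor [simp]:
  "f \<in> Cell B \<Longrightarrow> dom2 B f \<in> Mor B" "f \<in> Cell B \<Longrightarrow> cod2 B f \<in> Mor B"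
  using ax2[THEN conjunct1] by (auto)

lemma cell_src_trg [simp]:
  "f \<in> Cell B \<Longrightarrow> src B (cod2 B f) = src B (dom2 B f)"
  "f \<in> Cell B \<Longrightarrow> trg B (cod2 B f) = trg B (dom2 B f)"
  using ax2[THEN conjunct1] by (auto)

lemma id2_type [simp]:
  assumes "X \<in> Mor B"
  shows "id2 B X \<in> Cell B" "dom2 B (id2 B X) = X" "cod2 B (id2 B X) = X"
  using ax3[THEN conjunct1] assms by (auto simp: hom2_def)

lemma vcomp_type [simp]:
  assumes "f \<in> Cell B" "g \<in> Cell B" "cod2 B f = dom2 B g"
  shows "g \<cdot> f \<in> Cell B" "dom2 B (g \<cdot> f) = dom2 B f" "cod2 B (g \<cdot> f) = cod2 B g"
proof -
  have "g \<cdot> f \<in> hom2 B (dom2 B f) (cod2 B g)"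
    using ax4[THEN conjunct1] assms by (auto)
  then show "g \<cdot> f \<in> Cell B" "dom2 B (g \<cdot> f) = dom2 B f" "cod2 B (g \<cdot> f) = cod2 B g"
    by (auto simp: hom2_def)
qed

lemma vcomp_assoc [simp]:
  assumes "f \<in> Cell B" "g \<in> Cell B" "h \<in> Cell B" "cod2 B f = dom2 B g" "cod2 B g = dom2 B h"
  shows "(h \<cdot> g) \<cdot> f = h \<cdot> g \<cdot> f"
proof -
  have "h \<cdot> g \<cdot> f = (h \<cdot> g) \<cdot> f"
    using ax5[THEN conjunct1] assms by (auto)
  then show ?thesis by simp
qed

lemma vcomp_id [simp]:
  assumes "f \<in> Cell B"
  shows "cod2 B f = X \<Longrightarrow> id2 B X \<cdot> f = f" "dom2 B f = X \<Longrightarrow> f \<cdot> id2 B X = f"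
  using ax6[THEN conjunct1] assms by (auto)

lemma hcomp_type [simp]:
  assumes "X \<in> Mor B" "Y \<in> Mor B" "src B Y = trg B X"
  shows "Y \<otimes> X \<in> Mor B" "src B (Y \<otimes> X) = src B X" "trg B (Y \<otimes> X) = trg B Y"
proof -
  have "Y \<otimes> X \<in> hom B (src B X) (trg B Y)"
    using ax7[THEN conjunct1] assms by (auto)
  then show "Y \<otimes> X \<in> Mor B" "src B (Y \<otimes> X) = src B X" "trg B (Y \<otimes> X) = trg B Y"
    by (auto simp: hom_def)
qed

lemma hcomp2_type [simp]:
  assumes "f \<in> Cell B" "g \<in> Cell B" "src B (dom2 B g) = trg B (dom2 B f)"
  shows "hcomp2 B g f \<in> Cell B" "dom2 B (hcomp2 B g f) = dom2 B g \<otimes> dom2 B f"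
    "cod2 B (hcomp2 B g f) = cod2 B g \<otimes> cod2 B f"
proof -
  have "hcomp2 B g f \<in> hom2 B (dom2 B g \<otimes> dom2 B f) (cod2 B g \<otimes> cod2 B f)"
    using ax8[THEN conjunct1] assms by (auto)
  then show "hcomp2 B g f \<in> Cell B" "dom2 B (hcomp2 B g f) = dom2 B g \<otimes> dom2 B f"
    "cod2 B (hcomp2 B g f) = cod2 B g \<otimes> cod2 B f"
    by (auto simp: hom2_def)
qed

lemma hcomp2_id [simp]:
  assumes "X \<in> Mor B" "Y \<in> Mor B" "src B Y = trg B X"
  shows "hcomp2 B (id2 B Y) (id2 B X) = id2 B (Y \<otimes> X)"
  using ax9[THEN conjunct1] assms by (auto)

lemma hcomp2_vcomp:
  assumes "f \<in> Cell B" "f' \<in> Cell B" "g \<in> Cell B" "g' \<in> Cell B"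
    "cod2 B f = dom2 B f'" "cod2 B g = dom2 B g'" "src B (dom2 B g) = trg B (dom2 B f)"
  shows "hcomp2 B (g' \<cdot> g) (f' \<cdot> f) = hcomp2 B g' f' \<cdot> hcomp2 B g f"
  using ax10[THEN conjunct1] assms by (auto)

lemma unit1_type [simp]:
  assumes "a \<in> Obj B"
  shows "I a \<in> Mor B" "src B (I a) = a" "trg B (I a) = a"
  using ax11[THEN conjunct1] assms by (auto simp: hom_def)

section \<open>Inverses, whiskering and interchange\<close>

lemma inv2_props:
  assumes "iso2 B f"
  shows "inv2 B f \<in> Cell B" "dom2 B (inv2 B f) = cod2 B f" "cod2 B (inv2 B f) = dom2 B f"
    "inv2 B f \<cdot> f = id2 B (dom2 B f)" "f \<cdot> inv2 B f = id2 B (cod2 B f)"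
proof -
  have "\<exists>g. g \<in> hom2 B (cod2 B f) (dom2 B f) \<and>
        g \<cdot> f = id2 B (dom2 B f) \<and> f \<cdot> g = id2 B (cod2 B f)"
    using assms unfolding iso2_def by blast
  from someI_ex[OF this]
  show "inv2 B f \<in> Cell B" "dom2 B (inv2 B f) = cod2 B f" "cod2 B (inv2 B f) = dom2 B f"
    "inv2 B f \<cdot> f = id2 B (dom2 B f)" "f \<cdot> inv2 B f = id2 B (cod2 B f)"
    unfolding inv2_def by (auto simp: hom2_def)
qed

lemma iso2I:
  assumes "f \<in> Cell B" "g \<in> Cell B" "dom2 B g = cod2 B f" "cod2 B g = dom2 B f"
    "g \<cdot> f = id2 B (dom2 B f)" "f \<cdot> g = id2 B (cod2 B f)"
  shows "iso2 B f"
  using assms unfolding iso2_def hom2_def by blast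

text \<open>Composites are kept nested to the right, so a law \<open>g \<cdot> f = h\<close> does
  not match where \<open>f\<close> is composed with a further cell. This form makes every two-cell
  law usable as a rewrite rule inside a longer composite.\<close>

lemma vcomp_chain:
  assumes "g \<cdot> f = h" "g \<in> Cell B" "f \<in> Cell B" "cod2 B f = dom2 B g"
    "k \<in> Cell B" "cod2 B k = dom2 B f"
  shows "g \<cdot> f \<cdot> k = h \<cdot> k"
  using vcomp_assoc[of k f g] assms by simp

lemma lwh_type [simp]:
  assumes "f \<in> Cell B" "W \<in> Mor B" "src B W = trg B (dom2 B f)"
  shows "W \<lhd> f \<in> Cell B" "dom2 B (W \<lhd> f) = W \<otimes> dom2 B f" "cod2 B (W \<lhd> f) = W \<otimes> cod2 B f"
  using assms by (simp_all add: lwh_def)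

lemma rwh_type [simp]:
  assumes "f \<in> Cell B" "U \<in> Mor B" "src B (dom2 B f) = trg B U"
  shows "f \<rhd> U \<in> Cell B" "dom2 B (f \<rhd> U) = dom2 B f \<otimes> U" "cod2 B (f \<rhd> U) = cod2 B f \<otimes> U"
  using assms by (simp_all add: rwh_def)

lemma lwh_id [simp]: "\<lbrakk>W \<in> Mor B; X \<in> Mor B; src B W = trg B X\<rbrakk> \<Longrightarrow> W \<lhd> id2 B X = id2 B (W \<otimes> X)"
  by (simp add: lwh_def)

lemma rwh_id [simp]: "\<lbrakk>U \<in> Mor B; X \<in> Mor B; src B X = trg B U\<rbrakk> \<Longrightarrow> id2 B X \<rhd> U = id2 B (X \<otimes> U)"
  by (simp add: rwh_def)

lemma lwh_vcomp [simp]: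
  assumes "f \<in> Cell B" "g \<in> Cell B" "W \<in> Mor B" "cod2 B f = dom2 B g" "src B W = trg B (dom2 B f)"
  shows "W \<lhd> (g \<cdot> f) = (W \<lhd> g) \<cdot> (W \<lhd> f)"
  using assms hcomp2_vcomp[of f g "id2 B W" "id2 B W"] by (simp add: lwh_def)

lemma rwh_vcomp [simp]:
  assumes "f \<in> Cell B" "g \<in> Cell B" "U \<in> Mor B" "cod2 B f = dom2 B g" "src B (dom2 B f) = trg B U"
  shows "(g \<cdot> f) \<rhd> U = (g \<rhd> U) \<cdot> (f \<rhd> U)"
  using assms hcomp2_vcomp[of "id2 B U" "id2 B U" f g] by (simp add: rwh_def)

lemma hcomp2_eq_rl:
  assumes "f \<in> Cell B" "g \<in> Cell B" "src B (dom2 B f) = trg B (dom2 B g)"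
  shows "hcomp2 B f g = (f \<rhd> cod2 B g) \<cdot> (dom2 B f \<lhd> g)"
  using assms hcomp2_vcomp[of g "id2 B (cod2 B g)" "id2 B (dom2 B f)" f] by (simp add: rwh_def lwh_def)

lemma hcomp2_eq_lr:
  assumes "f \<in> Cell B" "g \<in> Cell B" "src B (dom2 B f) = trg B (dom2 B g)"
  shows "hcomp2 B f g = (cod2 B f \<lhd> g) \<cdot> (f \<rhd> dom2 B g)"
  using assms hcomp2_vcomp[of "id2 B (dom2 B g)" g f "id2 B (cod2 B f)"] by (simp add: rwh_def lwh_def)

text \<open>Both orders compute \<open>hcomp2 B f g\<close>. The whiskering objects \<open>V\<close>
  and \<open>X\<close> are variables tied by equations, because simplification normalises domains
  and codomains and the rule has to match the normalised terms.\<close>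

lemma interchange:
  assumes "f \<in> Cell B" "g \<in> Cell B" "src B (dom2 B f) = trg B (dom2 B g)" "cod2 B g = V" "dom2 B f = X"
  shows "(f \<rhd> V) \<cdot> (X \<lhd> g) = (cod2 B f \<lhd> g) \<cdot> (f \<rhd> dom2 B g)"
  using hcomp2_eq_rl[of f g] hcomp2_eq_lr[of f g] assms by simp

subsection \<open>Associator and unitors\<close>

lemma ass_iso:
  assumes "X \<in> Mor B" "Y \<in> Mor B" "Z \<in> Mor B" "src B Z = trg B Y" "src B Y = trg B X"
  shows "ass Z Y X \<in> hom2 B ((Z \<otimes> Y) \<otimes> X) (Z \<otimes> Y \<otimes> X)" "iso2 B (ass Z Y X)"
  using ax12[THEN conjunct1] assms by (auto)

lemma ass_type [simp]:
  assumes "X \<in> Mor B" "Y \<in> Mor B" "Z \<in> Mor B" "src B Z = trg B Y" "src B Y = trg B X"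
  shows "ass Z Y X \<in> Cell B" "dom2 B (ass Z Y X) = (Z \<otimes> Y) \<otimes> X" "cod2 B (ass Z Y X) = Z \<otimes> Y \<otimes> X"
    "ass' Z Y X \<in> Cell B" "dom2 B (ass' Z Y X) = Z \<otimes> Y \<otimes> X" "cod2 B (ass' Z Y X) = (Z \<otimes> Y) \<otimes> X"
    "ass' Z Y X \<cdot> ass Z Y X = id2 B ((Z \<otimes> Y) \<otimes> X)" "ass Z Y X \<cdot> ass' Z Y X = id2 B (Z \<otimes> Y \<otimes> X)"
  using ass_iso[OF assms] inv2_props[OF ass_iso(2)[OF assms]] by (auto simp: hom2_def)

lemma lu_iso:
  assumes "X \<in> Mor B"
  shows "lu X \<in> hom2 B (I (trg B X) \<otimes> X) X" "iso2 B (lu X)"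
  using ax14[THEN conjunct1] assms by (auto)

lemma ru_iso:
  assumes "X \<in> Mor B"
  shows "ru X \<in> hom2 B (X \<otimes> I (src B X)) X" "iso2 B (ru X)"
  using ax15[THEN conjunct1] assms by (auto)

lemma lu_type [simp]:
  assumes "X \<in> Mor B"
  shows "lu X \<in> Cell B" "dom2 B (lu X) = I (trg B X) \<otimes> X" "cod2 B (lu X) = X"
    "lu' X \<in> Cell B" "dom2 B (lu' X) = X" "cod2 B (lu' X) = I (trg B X) \<otimes> X"
    "lu' X \<cdot> lu X = id2 B (I (trg B X) \<otimes> X)" "lu X \<cdot> lu' X = id2 B X"
  using lu_iso[OF assms] inv2_props[OF lu_iso(2)[OF assms]] by (auto simp: hom2_def)

lemma ru_type [simp]:
  assumes "X \<in> Mor B"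
  shows "ru X \<in> Cell B" "dom2 B (ru X) = X \<otimes> I (src B X)" "cod2 B (ru X) = X"
    "ru' X \<in> Cell B" "dom2 B (ru' X) = X" "cod2 B (ru' X) = X \<otimes> I (src B X)"
    "ru' X \<cdot> ru X = id2 B (X \<otimes> I (src B X))" "ru X \<cdot> ru' X = id2 B X"
  using ru_iso[OF assms] inv2_props[OF ru_iso(2)[OF assms]] by (auto simp: hom2_def)

lemma vcomp_inv_cancel [simp]:
  assumes "k \<in> Cell B"
  shows "\<lbrakk>X \<in> Mor B; Y \<in> Mor B; Z \<in> Mor B; src B Z = trg B Y; src B Y = trg B X; cod2 B k = (Z \<otimes> Y) \<otimes> X\<rbrakk>
      \<Longrightarrow> ass' Z Y X \<cdot> ass Z Y X \<cdot> k = k"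
    "\<lbrakk>X \<in> Mor B; Y \<in> Mor B; Z \<in> Mor B; src B Z = trg B Y; src B Y = trg B X; cod2 B k = Z \<otimes> Y \<otimes> X\<rbrakk>
      \<Longrightarrow> ass Z Y X \<cdot> ass' Z Y X \<cdot> k = k"
    "\<lbrakk>X \<in> Mor B; cod2 B k = I (trg B X) \<otimes> X\<rbrakk> \<Longrightarrow> lu' X \<cdot> lu X \<cdot> k = k"
    "\<lbrakk>X \<in> Mor B; cod2 B k = X\<rbrakk> \<Longrightarrow> lu X \<cdot> lu' X \<cdot> k = k"
    "\<lbrakk>X \<in> Mor B; cod2 B k = X \<otimes> I (src B X)\<rbrakk> \<Longrightarrow> ru' X \<cdot> ru X \<cdot> k = k"
    "\<lbrakk>X \<in> Mor B; cod2 B k = X\<rbrakk> \<Longrightarrow> ru X \<cdot> ru' X \<cdot> k = k"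
  using assms by (simp_all flip: vcomp_assoc)

lemma vcomp_cancel_right:
  assumes "f \<cdot> h = g \<cdot> h" "k \<in> Cell B" "h \<in> Cell B" "f \<in> Cell B" "g \<in> Cell B"
    "cod2 B h = dom2 B f" "cod2 B h = dom2 B g" "cod2 B k = dom2 B h" "h \<cdot> k = id2 B (cod2 B h)"
  shows "f = g"
proof -
  have "(f \<cdot> h) \<cdot> k = (g \<cdot> h) \<cdot> k" using assms(1) by simp
  then have "f \<cdot> (h \<cdot> k) = g \<cdot> (h \<cdot> k)" using assms(2-8) by simp
  then show ?thesis using assms(2-) by simp
qed

lemma ass_nat:
  assumes "f \<in> Cell B" "g \<in> Cell B" "h \<in> Cell B"
    "src B (dom2 B h) = trg B (dom2 B g)" "src B (dom2 B g) = trg B (dom2 B f)"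
  shows "ass (cod2 B h) (cod2 B g) (cod2 B f) \<cdot> hcomp2 B (hcomp2 B h g) f
        = hcomp2 B h (hcomp2 B g f) \<cdot> ass (dom2 B h) (dom2 B g) (dom2 B f)"
  using ax13[THEN conjunct1] assms by (auto)

lemma ass_nat1:
  assumes "f \<in> Cell B" "Y \<in> Mor B" "X \<in> Mor B" "src B (dom2 B f) = trg B Y" "src B Y = trg B X" "cod2 B f = Z"
  shows "ass Z Y X \<cdot> (f \<rhd> Y \<rhd> X) = (f \<rhd> (Y \<otimes> X)) \<cdot> ass (dom2 B f) Y X"
  using ass_nat[of "id2 B X" "id2 B Y" f] assms by (simp add: rwh_def)

lemma ass_nat2:
  assumes "g \<in> Cell B" "Z \<in> Mor B" "X \<in> Mor B" "src B Z = trg B (dom2 B g)" "src B (dom2 B g) = trg B X" "cod2 B g = Y"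
  shows "ass Z Y X \<cdot> ((Z \<lhd> g) \<rhd> X) = (Z \<lhd> (g \<rhd> X)) \<cdot> ass Z (dom2 B g) X"
  using ass_nat[of "id2 B X" g "id2 B Z"] assms by (simp add: rwh_def lwh_def)

lemma ass_nat3:
  assumes "h \<in> Cell B" "Z \<in> Mor B" "Y \<in> Mor B" "src B Y = trg B (dom2 B h)" "src B Z = trg B Y" "cod2 B h = X"
  shows "ass Z Y X \<cdot> ((Z \<otimes> Y) \<lhd> h) = (Z \<lhd> (Y \<lhd> h)) \<cdot> ass Z Y (dom2 B h)"
  using ass_nat[of h "id2 B Y" "id2 B Z"] assms by (simp add: lwh_def)

lemma ass'_nat1:
  assumes "f \<in> Cell B" "Y \<in> Mor B" "X \<in> Mor B" "src B (dom2 B f) = trg B Y" "src B Y = trg B X" "cod2 B f = Z"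
  shows "ass' Z Y X \<cdot> (f \<rhd> (Y \<otimes> X)) = (f \<rhd> Y \<rhd> X) \<cdot> ass' (dom2 B f) Y X"
proof -
  have [simp]: "Z \<in> Mor B" "src B Z = src B (dom2 B f)" "trg B Z = trg B (dom2 B f)" using assms by auto
  have "ass' Z Y X \<cdot> (ass Z Y X \<cdot> (f \<rhd> Y \<rhd> X)) \<cdot> ass' (dom2 B f) Y X
      = ass' Z Y X \<cdot> ((f \<rhd> (Y \<otimes> X)) \<cdot> ass (dom2 B f) Y X) \<cdot> ass' (dom2 B f) Y X"
    using ass_nat1[OF assms] by simp
  then show ?thesis using assms by simp
qed

lemma ass'_nat2:
  assumes "g \<in> Cell B" "Z \<in> Mor B" "X \<in> Mor B" "src B Z = trg B (dom2 B g)" "src B (dom2 B g) = trg B X" "cod2 B g = Y"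
  shows "ass' Z Y X \<cdot> (Z \<lhd> (g \<rhd> X)) = ((Z \<lhd> g) \<rhd> X) \<cdot> ass' Z (dom2 B g) X"
proof -
  have [simp]: "Y \<in> Mor B" "src B Y = src B (dom2 B g)" "trg B Y = trg B (dom2 B g)" using assms by auto
  have "ass' Z Y X \<cdot> (ass Z Y X \<cdot> ((Z \<lhd> g) \<rhd> X)) \<cdot> ass' Z (dom2 B g) X
      = ass' Z Y X \<cdot> ((Z \<lhd> (g \<rhd> X)) \<cdot> ass Z (dom2 B g) X) \<cdot> ass' Z (dom2 B g) X"
    using ass_nat2[OF assms] by simp
  then show ?thesis using assms by simp
qed

lemma ass'_nat3:
  assumes "h \<in> Cell B" "Z \<in> Mor B" "Y \<in> Mor B" "src B Y = trg B (dom2 B h)" "src B Z = trg B Y" "cod2 B h = X"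
  shows "ass' Z Y X \<cdot> (Z \<lhd> (Y \<lhd> h)) = ((Z \<otimes> Y) \<lhd> h) \<cdot> ass' Z Y (dom2 B h)"
proof -
  have [simp]: "X \<in> Mor B" "src B X = src B (dom2 B h)" "trg B X = trg B (dom2 B h)" using assms by auto
  have "ass' Z Y X \<cdot> (ass Z Y X \<cdot> ((Z \<otimes> Y) \<lhd> h)) \<cdot> ass' Z Y (dom2 B h)
      = ass' Z Y X \<cdot> ((Z \<lhd> (Y \<lhd> h)) \<cdot> ass Z Y (dom2 B h)) \<cdot> ass' Z Y (dom2 B h)"
    using ass_nat3[OF assms] by simp
  then show ?thesis using assms by simp
qed

lemma lu_nat:
  assumes "f \<in> Cell B" "cod2 B f = Y" "trg B (dom2 B f) = b"
  shows "lu Y \<cdot> (I b \<lhd> f) = f \<cdot> lu (dom2 B f)"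
  using ax16[THEN conjunct1] assms by (auto simp: lwh_def)

lemma ru_nat:
  assumes "f \<in> Cell B" "cod2 B f = Y" "src B (dom2 B f) = a"
  shows "ru Y \<cdot> (f \<rhd> I a) = f \<cdot> ru (dom2 B f)"
  using ax17[THEN conjunct1] assms by (auto simp: rwh_def)

lemma lu'_nat:
  assumes "f \<in> Cell B" "cod2 B f = Y"
  shows "lu' Y \<cdot> f = (I (trg B (dom2 B f)) \<lhd> f) \<cdot> lu' (dom2 B f)"
proof -
  have [simp]: "Y \<in> Mor B" "src B Y = src B (dom2 B f)" "trg B Y = trg B (dom2 B f)" using assms by auto
  have "lu' Y \<cdot> (lu Y \<cdot> (I (trg B (dom2 B f)) \<lhd> f)) \<cdot> lu' (dom2 B f)
      = lu' Y \<cdot> (f \<cdot> lu (dom2 B f)) \<cdot> lu' (dom2 B f)"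
    using lu_nat[OF assms refl] by simp
  then show ?thesis using assms by simp
qed

lemma pentagon:
  assumes "X \<in> Mor B" "Y \<in> Mor B" "Z \<in> Mor B" "W \<in> Mor B"
    "src B W = trg B Z" "src B Z = trg B Y" "src B Y = trg B X"
  shows "(W \<lhd> ass Z Y X) \<cdot> ass W (Z \<otimes> Y) X \<cdot> (ass W Z Y \<rhd> X)
    = ass W Z (Y \<otimes> X) \<cdot> ass (W \<otimes> Z) Y X"
proof -
  have "vcs B [hcomp2 B (id2 B W) (ass Z Y X), ass W (Z \<otimes> Y) X, hcomp2 B (ass W Z Y) (id2 B X)]
        = ass W Z (Y \<otimes> X) \<cdot> ass (W \<otimes> Z) Y X"
    using ax18[THEN conjunct1] assms by (auto)
  then show ?thesis by (simp add: lwh_def rwh_def)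
qed

lemma triangle:
  assumes "X \<in> Mor B" "Y \<in> Mor B" "src B Y = trg B X"
  shows "(Y \<lhd> lu X) \<cdot> ass Y (I (trg B X)) X = ru Y \<rhd> X"
  using ax19 assms by (auto simp: lwh_def rwh_def)

text \<open>Naturality of the right unitor makes \<open>f\<close> conjugate to
  \<open>f \<rhd> I a\<close>. Cells may thus be compared after whiskering, which justifies the
  passage to actions.\<close>

lemma rwh_unit_faithful:
  assumes "f \<rhd> I a = g \<rhd> I a" "f \<in> Cell B" "g \<in> Cell B" "dom2 B f = dom2 B g" "cod2 B f = cod2 B g"
    "src B (dom2 B g) = a"
  shows "f = g"
proof -
  have "f \<cdot> ru (dom2 B g) = g \<cdot> ru (dom2 B g)"
    using ru_nat[of f "cod2 B f" a] ru_nat[of g "cod2 B g" a] assms by simp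
  then have "(f \<cdot> ru (dom2 B g)) \<cdot> ru' (dom2 B g) = (g \<cdot> ru (dom2 B g)) \<cdot> ru' (dom2 B g)" by simp
  then show ?thesis using assms by simp
qed

lemma lwh_unit_faithful:
  assumes "I a \<lhd> f = I a \<lhd> g" "f \<in> Cell B" "g \<in> Cell B" "dom2 B f = dom2 B g" "cod2 B f = cod2 B g"
    "trg B (dom2 B g) = a"
  shows "f = g"
proof -
  have "f \<cdot> lu (dom2 B g) = g \<cdot> lu (dom2 B g)"
    using lu_nat[of f "cod2 B f" a] lu_nat[of g "cod2 B g" a] assms by simp
  then have "(f \<cdot> lu (dom2 B g)) \<cdot> lu' (dom2 B g) = (g \<cdot> lu (dom2 B g)) \<cdot> lu' (dom2 B g)" by simp
  then show ?thesis using assms by simp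
qed

text \<open>Kelly's coherence argument: after whiskering with the unit, the triangle turns both left
  unitors into \<open>ru ?I\<close> and the pentagon matches the associators. The invertible cell
  \<open>?h\<close> is then cancelled and the whiskering removed by
  \<open>lwh_unit_faithful\<close>.\<close>

lemma lu_hcomp:
  assumes [simp]: "X \<in> Mor B" "Y \<in> Mor B" "src B Y = trg B X"
  shows "lu (Y \<otimes> X) \<cdot> ass (I (trg B Y)) Y X = lu Y \<rhd> X"
proof -
  let ?I = "I (trg B Y)"
  let ?h = "ass ?I (?I \<otimes> Y) X \<cdot> (ass ?I ?I Y \<rhd> X)"
  have "(?I \<lhd> (lu (Y \<otimes> X) \<cdot> ass ?I Y X)) \<cdot> ?h
      = (?I \<lhd> lu (Y \<otimes> X)) \<cdot> (?I \<lhd> ass ?I Y X) \<cdot> ass ?I (?I \<otimes> Y) X \<cdot> (ass ?I ?I Y \<rhd> X)"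
    by simp
  also have "\<dots> = (?I \<lhd> lu (Y \<otimes> X)) \<cdot> ass ?I ?I (Y \<otimes> X) \<cdot> ass (?I \<otimes> ?I) Y X"
    by (simp add: pentagon)
  also have "\<dots> = (ru ?I \<rhd> (Y \<otimes> X)) \<cdot> ass (?I \<otimes> ?I) Y X"
    using triangle[of "Y \<otimes> X" ?I] by (simp add: vcomp_chain)
  also have "\<dots> = ass ?I Y X \<cdot> (ru ?I \<rhd> Y \<rhd> X)"
    by (simp add: ass_nat1)
  also have "\<dots> = ass ?I Y X \<cdot> (((?I \<lhd> lu Y) \<cdot> ass ?I ?I Y) \<rhd> X)"
    using triangle[of Y ?I] by simp
  also have "\<dots> = (?I \<lhd> (lu Y \<rhd> X)) \<cdot> ?h"
    by (simp add: vcomp_chain[OF ass_nat2])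
  finally have *: "(?I \<lhd> (lu (Y \<otimes> X) \<cdot> ass ?I Y X)) \<cdot> ?h = (?I \<lhd> (lu Y \<rhd> X)) \<cdot> ?h" .
  have "(ass ?I ?I Y \<rhd> X) \<cdot> (ass' ?I ?I Y \<rhd> X) = id2 B ((?I \<otimes> ?I \<otimes> Y) \<otimes> X)"
    by (simp flip: rwh_vcomp)
  then have "?I \<lhd> (lu (Y \<otimes> X) \<cdot> ass ?I Y X) = ?I \<lhd> (lu Y \<rhd> X)"
    by (intro vcomp_cancel_right[OF *, of "(ass' ?I ?I Y \<rhd> X) \<cdot> ass' ?I (?I \<otimes> Y) X"])
      (simp_all add: vcomp_chain)
  then show ?thesis by (rule lwh_unit_faithful) simp_all
qed

subsection \<open>Left actions of 2-morphisms into and out of units\<close>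

lemma lwh_inv:
  assumes "g \<cdot> f = id2 B X" "f \<in> Cell B" "g \<in> Cell B" "W \<in> Mor B" "cod2 B f = dom2 B g" "dom2 B f = X"
    "src B W = trg B X"
  shows "(W \<lhd> g) \<cdot> (W \<lhd> f) = id2 B (W \<otimes> X)"
  using lwh_vcomp[of f g W] assms by auto

lemma rwh_inv:
  assumes "g \<cdot> f = id2 B X" "f \<in> Cell B" "g \<in> Cell B" "W \<in> Mor B" "cod2 B f = dom2 B g" "dom2 B f = X"
    "src B X = trg B W"
  shows "(g \<rhd> W) \<cdot> (f \<rhd> W) = id2 B (X \<otimes> W)"
  using rwh_vcomp[of f g W] assms by auto

lemma pentagon':
  assumes [simp]: "X \<in> Mor B" "Y \<in> Mor B" "Z \<in> Mor B" "W \<in> Mor B"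
    "src B W = trg B Z" "src B Z = trg B Y" "src B Y = trg B X"
  shows "ass (W \<otimes> Z) Y X \<cdot> (ass' W Z Y \<rhd> X)
    = ass' W Z (Y \<otimes> X) \<cdot> (W \<lhd> ass Z Y X) \<cdot> ass W (Z \<otimes> Y) X"
proof -
  have "ass' W Z (Y \<otimes> X) \<cdot> ((W \<lhd> ass Z Y X) \<cdot> ass W (Z \<otimes> Y) X \<cdot> (ass W Z Y \<rhd> X)) \<cdot> (ass' W Z Y \<rhd> X)
    = ass' W Z (Y \<otimes> X) \<cdot> (ass W Z (Y \<otimes> X) \<cdot> ass (W \<otimes> Z) Y X) \<cdot> (ass' W Z Y \<rhd> X)"
    by (simp only: pentagon[OF assms])
  then show ?thesis by (simp add: rwh_inv)
qed

lemma triangle':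
  assumes [simp]: "X \<in> Mor B" "Y \<in> Mor B" "src B Y = trg B X"
  shows "ass Y (I (trg B X)) X \<cdot> (ru' Y \<rhd> X) = Y \<lhd> lu' X"
proof -
  have "(Y \<lhd> lu' X) \<cdot> ((Y \<lhd> lu X) \<cdot> ass Y (I (trg B X)) X) \<cdot> (ru' Y \<rhd> X)
    = (Y \<lhd> lu' X) \<cdot> (ru Y \<rhd> X) \<cdot> (ru' Y \<rhd> X)"
    by (simp only: triangle[OF assms])
  then show ?thesis by (simp add: rwh_inv lwh_inv vcomp_chain[OF lwh_inv])
qed

lemma lu'_hcomp:
  assumes [simp]: "X \<in> Mor B" "Y \<in> Mor B" "src B Y = trg B X"
  shows "ass (I (trg B Y)) Y X \<cdot> (lu' Y \<rhd> X) = lu' (Y \<otimes> X)"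
proof -
  have "lu' (Y \<otimes> X) \<cdot> (lu (Y \<otimes> X) \<cdot> ass (I (trg B Y)) Y X) \<cdot> (lu' Y \<rhd> X)
    = lu' (Y \<otimes> X) \<cdot> (lu Y \<rhd> X) \<cdot> (lu' Y \<rhd> X)"
    by (simp only: lu_hcomp[OF assms])
  then show ?thesis by (simp add: rwh_inv)
qed

section \<open>Actions of evaluations, coevaluations and endomorphisms of units\<close>

definition evt :: "'c \<Rightarrow> 'm \<Rightarrow> 'm \<Rightarrow> bool" where
  "evt e W Z \<longleftrightarrow> W \<in> Mor B \<and> Z \<in> Mor B \<and> src B W = trg B Z \<and> trg B W = src B Z \<and>
    e \<in> Cell B \<and> dom2 B e = W \<otimes> Z \<and> cod2 B e = I (src B Z)"

definition coevt :: "'c \<Rightarrow> 'm \<Rightarrow> 'm \<Rightarrow> bool" where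
  "coevt c Z W \<longleftrightarrow> W \<in> Mor B \<and> Z \<in> Mor B \<and> src B W = trg B Z \<and> trg B W = src B Z \<and>
    c \<in> Cell B \<and> dom2 B c = I (trg B Z) \<and> cod2 B c = Z \<otimes> W"

definition endo :: "'c \<Rightarrow> 'o \<Rightarrow> bool" where
  "endo p a \<longleftrightarrow> a \<in> Obj B \<and> p \<in> Cell B \<and> dom2 B p = I a \<and> cod2 B p = I a"

text \<open>\<open>W\<close> and \<open>Z\<close> are arguments because \<open>e\<close> does not
  determine them: its domain is only the composite \<open>W \<otimes> Z\<close>.\<close>

definition eva :: "'c \<Rightarrow> 'm \<Rightarrow> 'm \<Rightarrow> 'm \<Rightarrow> 'c" where
  "eva e W Z V = lu V \<cdot> (e \<rhd> V) \<cdot> ass' W Z V"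

definition coeva :: "'c \<Rightarrow> 'm \<Rightarrow> 'm \<Rightarrow> 'm \<Rightarrow> 'c" where
  "coeva c Z W V = ass Z W V \<cdot> (c \<rhd> V) \<cdot> lu' V"

definition enda :: "'c \<Rightarrow> 'm \<Rightarrow> 'c" where
  "enda p V = lu V \<cdot> (p \<rhd> V) \<cdot> lu' V"

lemma evtD:
  assumes "evt e W Z"
  shows "W \<in> Mor B" "Z \<in> Mor B" "src B W = trg B Z" "trg B W = src B Z"
    "e \<in> Cell B" "dom2 B e = W \<otimes> Z" "cod2 B e = I (src B Z)"
  using assms by (auto simp: evt_def)

lemma coevtD:
  assumes "coevt c Z W"
  shows "W \<in> Mor B" "Z \<in> Mor B" "src B W = trg B Z" "trg B W = src B Z"
    "c \<in> Cell B" "dom2 B c = I (trg B Z)" "cod2 B c = Z \<otimes> W"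
  using assms by (auto simp: coevt_def)

lemma endoD:
  assumes "endo p a"
  shows "a \<in> Obj B" "p \<in> Cell B" "dom2 B p = I a" "cod2 B p = I a"
  using assms by (auto simp: endo_def)

lemma eva_type [simp]:
  assumes "evt e W Z" "V \<in> Mor B" "trg B V = src B Z"
  shows "eva e W Z V \<in> Cell B" "dom2 B (eva e W Z V) = W \<otimes> Z \<otimes> V" "cod2 B (eva e W Z V) = V"
  using evtD[OF assms(1)] assms(2,3) by (simp_all add: eva_def)

lemma coeva_type [simp]:
  assumes "coevt c Z W" "V \<in> Mor B" "trg B V = trg B Z"
  shows "coeva c Z W V \<in> Cell B" "dom2 B (coeva c Z W V) = V" "cod2 B (coeva c Z W V) = Z \<otimes> W \<otimes> V"
  using coevtD[OF assms(1)] assms(2,3) by (simp_all add: coeva_def)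

lemma enda_type [simp]:
  assumes "endo p (trg B V)" "V \<in> Mor B"
  shows "enda p V \<in> Cell B" "dom2 B (enda p V) = V" "cod2 B (enda p V) = V"
  using endoD[OF assms(1)] assms(2) by (simp_all add: enda_def)

lemma cod2_props:
  assumes "g \<in> Cell B" "cod2 B g = V"
  shows "V \<in> Mor B" "src B V = src B (dom2 B g)" "trg B V = trg B (dom2 B g)"
  using assms by auto

lemma eva_nat:
  assumes "evt e W Z" "g \<in> Cell B" "trg B (dom2 B g) = src B Z" "cod2 B g = V"
  shows "eva e W Z V \<cdot> (W \<lhd> Z \<lhd> g) = g \<cdot> eva e W Z (dom2 B g)"
proof -
  note [simp] = evtD[OF assms(1)] assms(2-4) cod2_props[OF assms(2,4)]
  show ?thesis
    by (simp add: eva_def ass'_nat3 vcomp_chain[OF interchange] vcomp_chain[OF lu_nat])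
qed

lemma coeva_nat:
  assumes "coevt c Z W" "g \<in> Cell B" "trg B (dom2 B g) = trg B Z" "cod2 B g = V"
  shows "coeva c Z W V \<cdot> g = (Z \<lhd> W \<lhd> g) \<cdot> coeva c Z W (dom2 B g)"
proof -
  note [simp] = coevtD[OF assms(1)] assms(2-4) cod2_props[OF assms(2,4)]
  show ?thesis
    by (simp add: coeva_def lu'_nat vcomp_chain[OF interchange] vcomp_chain[OF ass_nat3])
qed

lemma enda_nat:
  assumes "endo p (trg B (dom2 B g))" "g \<in> Cell B" "cod2 B g = V"
  shows "enda p V \<cdot> g = g \<cdot> enda p (dom2 B g)"
proof -
  note [simp] = endoD[OF assms(1)] assms(2,3) cod2_props[OF assms(2,3)]
  show ?thesis
    by (simp add: enda_def lu'_nat vcomp_chain[OF interchange] vcomp_chain[OF lu_nat])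
qed

text \<open>At \<open>V = I a\<close> the unitors around \<open>p \<rhd> I a\<close> cancel, and
  \<open>rwh_unit_faithful\<close> recovers \<open>p\<close>. The basic identities between values of
  \<open>D_r\<close> and \<open>D_l\<close> are checked through this criterion.\<close>

lemma enda_faithful:
  assumes "\<And>V. \<lbrakk>V \<in> Mor B; trg B V = a\<rbrakk> \<Longrightarrow> enda p V = enda q V" "endo p a" "endo q a"
  shows "p = q"
proof -
  note [simp] = endoD[OF assms(2)] endoD[OF assms(3)]
  have "lu' (I a) \<cdot> enda p (I a) \<cdot> lu (I a) = lu' (I a) \<cdot> enda q (I a) \<cdot> lu (I a)"
    using assms(1)[of "I a"] by simp
  then have "p \<rhd> I a = q \<rhd> I a" by (simp add: enda_def)
  then show ?thesis by (rule rwh_unit_faithful) simp_all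
qed

lemma eva_precomp1:
  assumes "evt e W Z" "f \<in> Cell B" "cod2 B f = W" "dom2 B f = W'" "V \<in> Mor B" "trg B V = src B Z"
  shows "evt (e \<cdot> (f \<rhd> Z)) W' Z" "eva (e \<cdot> (f \<rhd> Z)) W' Z V = eva e W Z V \<cdot> (f \<rhd> (Z \<otimes> V))"
proof -
  have [simp]: "W' \<in> Mor B" "src B W' = src B W" "trg B W' = trg B W"
    using assms(2-4) cell_src_trg[of f] by auto
  note [simp] = evtD[OF assms(1)] assms(2-)
  show "evt (e \<cdot> (f \<rhd> Z)) W' Z" by (simp add: evt_def)
  show "eva (e \<cdot> (f \<rhd> Z)) W' Z V = eva e W Z V \<cdot> (f \<rhd> (Z \<otimes> V))"
    by (simp add: eva_def ass'_nat1)
qed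

lemma eva_precomp2:
  assumes "evt e W Z" "g \<in> Cell B" "cod2 B g = Z" "dom2 B g = Z'" "V \<in> Mor B" "trg B V = src B Z"
  shows "evt (e \<cdot> (W \<lhd> g)) W Z'" "eva (e \<cdot> (W \<lhd> g)) W Z' V = eva e W Z V \<cdot> (W \<lhd> (g \<rhd> V))"
proof -
  have [simp]: "Z' \<in> Mor B" "src B Z' = src B Z" "trg B Z' = trg B Z"
    using assms(2-4) cell_src_trg[of g] by auto
  note [simp] = evtD[OF assms(1)] assms(2-)
  show "evt (e \<cdot> (W \<lhd> g)) W Z'" by (simp add: evt_def)
  show "eva (e \<cdot> (W \<lhd> g)) W Z' V = eva e W Z V \<cdot> (W \<lhd> (g \<rhd> V))"
    by (simp add: eva_def ass'_nat2)
qed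

lemma coeva_postcomp1:
  assumes "coevt c Z W" "f \<in> Cell B" "dom2 B f = Z" "cod2 B f = Z'" "V \<in> Mor B" "trg B V = trg B Z"
  shows "coevt ((f \<rhd> W) \<cdot> c) Z' W" "coeva ((f \<rhd> W) \<cdot> c) Z' W V = (f \<rhd> (W \<otimes> V)) \<cdot> coeva c Z W V"
proof -
  have [simp]: "Z' \<in> Mor B" "src B Z' = src B Z" "trg B Z' = trg B Z"
    using assms(2-4) cell_src_trg[of f] by auto
  note [simp] = coevtD[OF assms(1)] assms(2-)
  show "coevt ((f \<rhd> W) \<cdot> c) Z' W" by (simp add: coevt_def)
  show "coeva ((f \<rhd> W) \<cdot> c) Z' W V = (f \<rhd> (W \<otimes> V)) \<cdot> coeva c Z W V"
    by (simp add: coeva_def vcomp_chain[OF ass_nat1])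
qed

lemma coeva_postcomp2:
  assumes "coevt c Z W" "g \<in> Cell B" "dom2 B g = W" "cod2 B g = W'" "V \<in> Mor B" "trg B V = trg B Z"
  shows "coevt ((Z \<lhd> g) \<cdot> c) Z W'" "coeva ((Z \<lhd> g) \<cdot> c) Z W' V = (Z \<lhd> (g \<rhd> V)) \<cdot> coeva c Z W V"
proof -
  have [simp]: "W' \<in> Mor B" "src B W' = src B W" "trg B W' = trg B W"
    using assms(2-4) cell_src_trg[of g] by auto
  note [simp] = coevtD[OF assms(1)] assms(2-)
  show "coevt ((Z \<lhd> g) \<cdot> c) Z W'" by (simp add: coevt_def)
  show "coeva ((Z \<lhd> g) \<cdot> c) Z W' V = (Z \<lhd> (g \<rhd> V)) \<cdot> coeva c Z W V"
    by (simp add: coeva_def vcomp_chain[OF ass_nat2])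
qed

text \<open>The associators at the junction of the two actions cancel. This expresses a closed loop
  by actions.\<close>

lemma enda_eva_coeva:
  assumes "evt e P Q" "coevt c P Q" "V \<in> Mor B" "trg B V = src B Q"
  shows "endo (e \<cdot> c) (src B Q)" "enda (e \<cdot> c) V = eva e P Q V \<cdot> coeva c P Q V"
proof -
  note [simp] = evtD[OF assms(1)] coevtD(5-7)[OF assms(2)] assms(3,4)
  show "endo (e \<cdot> c) (src B Q)" by (simp add: endo_def)
  show "enda (e \<cdot> c) V = eva e P Q V \<cdot> coeva c P Q V"
    by (simp add: enda_def eva_def coeva_def)
qed

text \<open>Coherence for actions: \<open>lu_hcomp\<close> absorbs the unitor and the pentagon
  rebrackets, so whiskering on the right merely enlarges the argument \<open>V\<close> to
  \<open>V \<otimes> U\<close>, up to associators.\<close>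

lemma eva_rwh:
  assumes "evt e W Z" "V \<in> Mor B" "trg B V = src B Z" "U \<in> Mor B" "trg B U = src B V"
  shows "eva e W Z V \<rhd> U = eva e W Z (V \<otimes> U) \<cdot> (W \<lhd> ass Z V U) \<cdot> ass W (Z \<otimes> V) U"
proof -
  note [simp] = evtD[OF assms(1)] assms(2-)
  have "eva e W Z V \<rhd> U = lu (V \<otimes> U) \<cdot> ass (I (trg B V)) V U \<cdot> (e \<rhd> V \<rhd> U) \<cdot> (ass' W Z V \<rhd> U)"
    using lu_hcomp[of U V] by (simp add: eva_def flip: vcomp_assoc)
  then show ?thesis
    by (simp add: vcomp_chain[OF ass_nat1] eva_def pentagon')
qed

lemma coeva_rwh:
  assumes "coevt c Z W" "V \<in> Mor B" "trg B V = trg B Z" "U \<in> Mor B" "trg B U = src B V"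
  shows "coeva c Z W (V \<otimes> U) = (Z \<lhd> ass W V U) \<cdot> ass Z (W \<otimes> V) U \<cdot> (coeva c Z W V \<rhd> U)"
proof -
  note [simp] = coevtD[OF assms(1)] assms(2-)
  have "coeva c Z W (V \<otimes> U) = ass Z W (V \<otimes> U) \<cdot> (c \<rhd> (V \<otimes> U)) \<cdot> ass (I (trg B V)) V U \<cdot> (lu' V \<rhd> U)"
    using lu'_hcomp[of U V] by (simp add: coeva_def)
  also have "\<dots> = (ass Z W (V \<otimes> U) \<cdot> ass (Z \<otimes> W) V U) \<cdot> (c \<rhd> V \<rhd> U) \<cdot> (lu' V \<rhd> U)"
    by (simp add: vcomp_chain[OF ass_nat1])
  also have "\<dots> = ((Z \<lhd> ass W V U) \<cdot> ass Z (W \<otimes> V) U \<cdot> (ass Z W V \<rhd> U)) \<cdot> (c \<rhd> V \<rhd> U) \<cdot> (lu' V \<rhd> U)"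
    by (subst pentagon) simp_all
  also have "\<dots> = (Z \<lhd> ass W V U) \<cdot> ass Z (W \<otimes> V) U \<cdot> (coeva c Z W V \<rhd> U)"
    by (simp add: coeva_def)
  finally show ?thesis .
qed

lemma enda_rwh:
  assumes "endo p (trg B V)" "V \<in> Mor B" "U \<in> Mor B" "trg B U = src B V"
  shows "enda p V \<rhd> U = enda p (V \<otimes> U)"
proof -
  note [simp] = endoD[OF assms(1)] assms(2-)
  have "enda p V \<rhd> U = lu (V \<otimes> U) \<cdot> ass (I (trg B V)) V U \<cdot> (p \<rhd> V \<rhd> U) \<cdot> (lu' V \<rhd> U)"
    using lu_hcomp[of U V] by (simp add: enda_def flip: vcomp_assoc)
  also have "\<dots> = lu (V \<otimes> U) \<cdot> (p \<rhd> (V \<otimes> U)) \<cdot> ass (I (trg B V)) V U \<cdot> (lu' V \<rhd> U)"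
    by (simp add: vcomp_chain[OF ass_nat1])
  also have "\<dots> = enda p (V \<otimes> U)"
    using lu'_hcomp[of U V] by (simp add: enda_def)
  finally show ?thesis .
qed

section \<open>Transposition along an evaluation and a coevaluation\<close>

definition transp :: "'c \<Rightarrow> 'c \<Rightarrow> 'm \<Rightarrow> 'm \<Rightarrow> 'm \<Rightarrow> 'c" where
  "transp e c W Z V = lu V \<cdot> (e \<rhd> V) \<cdot> ass' W Z V \<cdot> (W \<lhd> c) \<cdot> ru' W"

lemma transp_type [simp]:
  assumes "evt e W Z" "coevt c Z V"
  shows "transp e c W Z V \<in> Cell B" "dom2 B (transp e c W Z V) = W" "cod2 B (transp e c W Z V) = V"
  using evtD[OF assms(1)] coevtD[OF assms(2)] by (simp_all add: transp_def)

text \<open>The triangle identity replaces the right unitor in \<open>transp\<close> by the left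
  unitor contained in \<open>coeva\<close>, so the whiskered transpose is a composite of two
  actions. \<open>mate\<close>, \<open>dag_comp_iso\<close> and the second zigzag of
  \<open>has_left_adjoints\<close> are all instances of \<open>transp\<close>.\<close>

lemma transp_rwh:
  assumes "evt e W Z" "coevt c Z V" "U \<in> Mor B" "trg B U = trg B Z"
  shows "transp e c W Z V \<rhd> U = eva e W Z (V \<otimes> U) \<cdot> (W \<lhd> coeva c Z V U)"
proof -
  note [simp] = evtD[OF assms(1)] coevtD[OF assms(2)] assms
  have "transp e c W Z V \<rhd> U = (eva e W Z V \<rhd> U) \<cdot> ((W \<lhd> c) \<rhd> U) \<cdot> (ru' W \<rhd> U)"
    by (simp add: transp_def eva_def)
  also have "\<dots> = eva e W Z (V \<otimes> U) \<cdot> (W \<lhd> ass Z V U) \<cdot> ass W (Z \<otimes> V) U \<cdot> ((W \<lhd> c) \<rhd> U) \<cdot> (ru' W \<rhd> U)"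
    by (simp add: eva_rwh)
  also have "\<dots> = eva e W Z (V \<otimes> U) \<cdot> (W \<lhd> ass Z V U) \<cdot> (W \<lhd> (c \<rhd> U)) \<cdot> ass W (I (trg B U)) U \<cdot> (ru' W \<rhd> U)"
    by (simp add: vcomp_chain[OF ass_nat2])
  also have "\<dots> = eva e W Z (V \<otimes> U) \<cdot> (W \<lhd> coeva c Z V U)"
    using triangle'[of U W] by (simp add: coeva_def)
  finally show ?thesis .
qed

text \<open>The counterpart for the first zigzag: triangle and pentagon absorb its unitors and
  associators, leaving two actions.\<close>

lemma zigzag_rwh:
  assumes "evt e W Z" "coevt c Z W" "U \<in> Mor B" "trg B U = src B Z"
  shows "(ru Z \<cdot> (Z \<lhd> e) \<cdot> ass Z W Z \<cdot> (c \<rhd> Z) \<cdot> lu' Z) \<rhd> U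
    = (Z \<lhd> eva e W Z U) \<cdot> coeva c Z W (Z \<otimes> U)"
proof -
  note [simp] = evtD[OF assms(1)] coevtD[OF assms(2)] assms(3-)
  have "(ru Z \<cdot> (Z \<lhd> e) \<cdot> ass Z W Z \<cdot> (c \<rhd> Z) \<cdot> lu' Z) \<rhd> U
      = (ru Z \<rhd> U) \<cdot> ((Z \<lhd> e) \<rhd> U) \<cdot> (ass Z W Z \<rhd> U) \<cdot> (c \<rhd> Z \<rhd> U) \<cdot> (lu' Z \<rhd> U)"
    by simp
  also have "\<dots> = (Z \<lhd> lu U) \<cdot> ass Z (I (trg B U)) U \<cdot> ((Z \<lhd> e) \<rhd> U) \<cdot> (ass Z W Z \<rhd> U) \<cdot> (c \<rhd> Z \<rhd> U) \<cdot> (lu' Z \<rhd> U)"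
    using triangle[of U Z] by (simp flip: vcomp_assoc)
  also have "\<dots> = (Z \<lhd> lu U) \<cdot> (Z \<lhd> (e \<rhd> U)) \<cdot> (Z \<lhd> ass' W Z U) \<cdot>
      ((Z \<lhd> ass W Z U) \<cdot> ass Z (W \<otimes> Z) U \<cdot> (ass Z W Z \<rhd> U)) \<cdot> (c \<rhd> Z \<rhd> U) \<cdot> (lu' Z \<rhd> U)"
    by (simp add: vcomp_chain[OF ass_nat2] vcomp_chain[OF lwh_inv])
  also have "\<dots> = (Z \<lhd> eva e W Z U) \<cdot> (ass Z W (Z \<otimes> U) \<cdot> ass (Z \<otimes> W) Z U) \<cdot> (c \<rhd> Z \<rhd> U) \<cdot> (lu' Z \<rhd> U)"
    by (subst pentagon) (simp_all add: eva_def)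
  also have "\<dots> = (Z \<lhd> eva e W Z U) \<cdot> ass Z W (Z \<otimes> U) \<cdot> (c \<rhd> (Z \<otimes> U)) \<cdot> ass (I (trg B Z)) Z U \<cdot> (lu' Z \<rhd> U)"
    by (simp add: vcomp_chain[OF ass_nat1])
  also have "\<dots> = (Z \<lhd> eva e W Z U) \<cdot> coeva c Z W (Z \<otimes> U)"
    using lu'_hcomp[of U Z] by (simp add: coeva_def)
  finally show ?thesis .
qed

subsection \<open>Adjunctions\<close>

lemma lwh_lift:
  assumes "g \<cdot> f = h" "f \<in> Cell B" "g \<in> Cell B" "cod2 B f = dom2 B g" "W \<in> Mor B"
    "src B W = trg B (dom2 B f)"
  shows "(W \<lhd> g) \<cdot> (W \<lhd> f) = W \<lhd> h"
  using lwh_vcomp[of f g W] assms by simp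

lemma coeva_nat':
  assumes "coevt c Z W" "g \<in> Cell B" "trg B V = trg B Z" "dom2 B g = V"
  shows "(Z \<lhd> W \<lhd> g) \<cdot> coeva c Z W V = coeva c Z W (cod2 B g) \<cdot> g"
  using coeva_nat[of c Z W g] assms by simp

lemma ass'_nat3':
  assumes "h \<in> Cell B" "Z \<in> Mor B" "Y \<in> Mor B" "src B Y = trg B X" "src B Z = trg B Y" "dom2 B h = X"
  shows "((Z \<otimes> Y) \<lhd> h) \<cdot> ass' Z Y X = ass' Z Y (cod2 B h) \<cdot> (Z \<lhd> (Y \<lhd> h))"
  using ass'_nat3[of h Z Y] assms by simp

text \<open>The rewrite rules below terminate together: naturality of the actions lowers the whiskering
  depth, associators move to the right and their inverses to the left. The simplifier distributes
  whiskering over composition, hence the variants under \<open>\<lhd>\<close> and inside a longer composite.\<close>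

lemmas eva_nats = eva_nat vcomp_chain[OF eva_nat] lwh_lift[OF eva_nat] vcomp_chain[OF lwh_lift[OF eva_nat]]
lemmas coeva_nats = coeva_nat' vcomp_chain[OF coeva_nat'] lwh_lift[OF coeva_nat']
  vcomp_chain[OF lwh_lift[OF coeva_nat']]
lemmas ass_nat3s = ass_nat3 vcomp_chain[OF ass_nat3] lwh_lift[OF ass_nat3] vcomp_chain[OF lwh_lift[OF ass_nat3]]
  lwh_lift[OF lwh_lift[OF ass_nat3]] vcomp_chain[OF lwh_lift[OF lwh_lift[OF ass_nat3]]]
lemmas ass'_nat3s = ass'_nat3' vcomp_chain[OF ass'_nat3'] lwh_lift[OF ass'_nat3']
  vcomp_chain[OF lwh_lift[OF ass'_nat3']]
lemmas lwh_invs = lwh_inv vcomp_chain[OF lwh_inv] lwh_inv[OF lwh_inv] vcomp_chain[OF lwh_inv[OF lwh_inv]]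
  lwh_inv[OF lwh_inv[OF lwh_inv]] vcomp_chain[OF lwh_inv[OF lwh_inv[OF lwh_inv]]]
lemmas interchanges = interchange vcomp_chain[OF interchange] lwh_lift[OF interchange]
  vcomp_chain[OF lwh_lift[OF interchange]]

text \<open>\<open>W\<close> is left adjoint to \<open>Z\<close>. The triangle identities are
  imposed on the actions at all 1-morphisms, where they contain no explicit associators or
  unitors.\<close>

definition adj :: "'m \<Rightarrow> 'm \<Rightarrow> 'c \<Rightarrow> 'c \<Rightarrow> bool" where
  "adj W Z e c \<longleftrightarrow> evt e W Z \<and> coevt c Z W \<and>
    (\<forall>V \<in> Mor B. trg B V = src B Z \<longrightarrow> (Z \<lhd> eva e W Z V) \<cdot> coeva c Z W (Z \<otimes> V) = id2 B (Z \<otimes> V)) \<and>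
    (\<forall>U \<in> Mor B. trg B U = trg B Z \<longrightarrow> eva e W Z (W \<otimes> U) \<cdot> (W \<lhd> coeva c Z W U) = id2 B (W \<otimes> U))"

lemma adj_zigzag:
  assumes "adj W Z e c"
  shows "\<lbrakk>V \<in> Mor B; trg B V = src B Z\<rbrakk> \<Longrightarrow> (Z \<lhd> eva e W Z V) \<cdot> coeva c Z W (Z \<otimes> V) = id2 B (Z \<otimes> V)"
    "\<lbrakk>U \<in> Mor B; trg B U = trg B Z\<rbrakk> \<Longrightarrow> eva e W Z (W \<otimes> U) \<cdot> (W \<lhd> coeva c Z W U) = id2 B (W \<otimes> U)"
  using assms by (auto simp: adj_def)

lemma adjD:
  assumes "adj W Z e c"
  shows "evt e W Z" "coevt c Z W" "W \<in> Mor B" "Z \<in> Mor B" "src B W = trg B Z" "trg B W = src B Z"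
  using assms by (auto simp: adj_def evt_def)

lemmas adj_zz = adj_zigzag vcomp_chain[OF adj_zigzag(1)] vcomp_chain[OF adj_zigzag(2)]
  lwh_lift[OF adj_zigzag(1)] vcomp_chain[OF lwh_lift[OF adj_zigzag(1)]]
  lwh_lift[OF adj_zigzag(2)] vcomp_chain[OF lwh_lift[OF adj_zigzag(2)]]

text \<open>Naturality of \<open>eva e'\<close> carries \<open>eva e\<close> past it, and the zigzag
  of the adjunction removes the created pair. The transpose is thus the comparison cell through
  which \<open>e'\<close> factors over \<open>e\<close>.\<close>

lemma transp_eva:
  assumes "adj W Z e c" "evt e' W' Z" "U \<in> Mor B" "trg B U = src B Z"
  shows "eva e W Z U \<cdot> (transp e' c W' Z W \<rhd> (Z \<otimes> U)) = eva e' W' Z U"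
proof -
  note [simp] = adjD[OF assms(1)] assms(2-) evtD(1,3,4)[OF assms(2)]
  have "eva e W Z U \<cdot> (transp e' c W' Z W \<rhd> (Z \<otimes> U))
      = (eva e W Z U \<cdot> eva e' W' Z (W \<otimes> Z \<otimes> U)) \<cdot> (W' \<lhd> coeva c Z W (Z \<otimes> U))"
    by (simp add: transp_rwh)
  also have "\<dots> = eva e' W' Z U \<cdot> (W' \<lhd> ((Z \<lhd> eva e W Z U) \<cdot> coeva c Z W (Z \<otimes> U)))"
    by (simp add: eva_nats)
  also have "\<dots> = eva e' W' Z U"
    by (simp add: adj_zigzag[OF assms(1)] del: lwh_vcomp)
  finally show ?thesis .
qed

lemma transp_coeva:
  assumes "adj W' Z e' c'" "coevt c Z W" "U \<in> Mor B" "trg B U = trg B Z"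
  shows "(Z \<lhd> (transp e' c W' Z W \<rhd> U)) \<cdot> coeva c' Z W' U = coeva c Z W U"
proof -
  note [simp] = adjD[OF assms(1)] assms(2-) coevtD(1,3,4)[OF assms(2)]
  show ?thesis
    by (simp add: transp_rwh coeva_nats adj_zz[OF assms(1)])
qed

text \<open>Uniqueness of left adjoints. After whiskering with a unit, \<open>transp_eva\<close>
  exchanges the evaluation of \<open>W\<close> for that of \<open>W'\<close>, and a zigzag of the
  second adjunction remains.\<close>

lemma transp_inverse:
  assumes "adj W Z e c" "adj W' Z e' c'"
  shows "transp e c' W Z W' \<cdot> transp e' c W' Z W = id2 B W'"
proof -
  note [simp] = adjD[OF assms(1)] adjD[OF assms(2)]
  let ?U = "I (trg B Z)"
  have "(transp e c' W Z W' \<cdot> transp e' c W' Z W) \<rhd> ?U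
      = eva e W Z (W' \<otimes> ?U) \<cdot> (W \<lhd> coeva c' Z W' ?U) \<cdot> (transp e' c W' Z W \<rhd> ?U)"
    by (simp add: transp_rwh[of e W Z c'])
  also have "\<dots> = (eva e W Z (W' \<otimes> ?U) \<cdot> (transp e' c W' Z W \<rhd> (Z \<otimes> W' \<otimes> ?U))) \<cdot> (W' \<lhd> coeva c' Z W' ?U)"
    by (simp add: interchange)
  also have "\<dots> = id2 B W' \<rhd> ?U"
    by (subst transp_eva[OF assms(1)]) (simp_all add: adj_zigzag[OF assms(2)])
  finally show ?thesis by (rule rwh_unit_faithful) simp_all
qed

section \<open>Composition of adjunctions\<close>

definition evcomp :: "'c \<Rightarrow> 'm \<Rightarrow> 'm \<Rightarrow> 'c \<Rightarrow> 'm \<Rightarrow> 'm \<Rightarrow> 'c" where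
  "evcomp e' W' Z' e W Z = e \<cdot> (W \<lhd> eva e' W' Z' Z) \<cdot> ass W W' (Z' \<otimes> Z)"

definition coevcomp :: "'c \<Rightarrow> 'm \<Rightarrow> 'm \<Rightarrow> 'c \<Rightarrow> 'm \<Rightarrow> 'm \<Rightarrow> 'c" where
  "coevcomp c' W' Z' c W Z = ass' Z' Z (W \<otimes> W') \<cdot> (Z' \<lhd> coeva c Z W W') \<cdot> c'"

lemma evcomp_evt [simp]:
  assumes "evt e' W' Z'" "evt e W Z" "src B Z' = trg B Z"
  shows "evt (evcomp e' W' Z' e W Z) (W \<otimes> W') (Z' \<otimes> Z)"
  using evtD[OF assms(1)] evtD[OF assms(2)] assms by (simp add: evt_def evcomp_def)

lemma coevcomp_coevt [simp]:
  assumes "coevt c' Z' W'" "coevt c Z W" "src B Z' = trg B Z"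
  shows "coevt (coevcomp c' W' Z' c W Z) (Z' \<otimes> Z) (W \<otimes> W')"
  using coevtD[OF assms(1)] coevtD[OF assms(2)] assms by (simp add: coevt_def coevcomp_def)

text \<open>Bracketed to the right, the evaluation of a composite is the action of \<open>e'\<close>
  under \<open>W\<close> followed by the action of \<open>e\<close>; the pentagon collects the
  associators.\<close>

lemma eva_evcomp:
  assumes "evt e' W' Z'" "evt e W Z" "src B Z' = trg B Z" "U \<in> Mor B" "trg B U = src B Z"
  shows "eva (evcomp e' W' Z' e W Z) (W \<otimes> W') (Z' \<otimes> Z) U
    = eva e W Z U \<cdot> (W \<lhd> eva e' W' Z' (Z \<otimes> U)) \<cdot> ass W W' (Z' \<otimes> Z \<otimes> U) \<cdot> ((W \<otimes> W') \<lhd> ass Z' Z U)"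
proof -
  note [simp] = evtD[OF assms(1)] evtD[OF assms(2)] assms
  have eq: "lu U \<cdot> (e \<rhd> U) = eva e W Z U \<cdot> ass W Z U"
    by (simp add: eva_def)
  have "eva (evcomp e' W' Z' e W Z) (W \<otimes> W') (Z' \<otimes> Z) U
      = (lu U \<cdot> (e \<rhd> U)) \<cdot> ((W \<lhd> eva e' W' Z' Z) \<rhd> U) \<cdot> (ass W W' (Z' \<otimes> Z) \<rhd> U) \<cdot> ass' (W \<otimes> W') (Z' \<otimes> Z) U"
    unfolding eva_def[of "evcomp e' W' Z' e W Z"] unfolding evcomp_def by simp
  also have "\<dots> = eva e W Z U \<cdot> (W \<lhd> (eva e' W' Z' Z \<rhd> U)) \<cdot> ass W (W' \<otimes> Z' \<otimes> Z) U \<cdot> (ass W W' (Z' \<otimes> Z) \<rhd> U) \<cdot> ass' (W \<otimes> W') (Z' \<otimes> Z) U"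
    by (simp add: eq vcomp_chain[OF ass_nat2])
  also have "\<dots> = eva e W Z U \<cdot> (W \<lhd> eva e' W' Z' (Z \<otimes> U)) \<cdot> (W \<lhd> W' \<lhd> ass Z' Z U) \<cdot>
     ((W \<lhd> ass W' (Z' \<otimes> Z) U) \<cdot> ass W (W' \<otimes> Z' \<otimes> Z) U \<cdot> (ass W W' (Z' \<otimes> Z) \<rhd> U)) \<cdot> ass' (W \<otimes> W') (Z' \<otimes> Z) U"
    by (simp add: eva_rwh)
  also have "\<dots> = eva e W Z U \<cdot> (W \<lhd> eva e' W' Z' (Z \<otimes> U)) \<cdot> (W \<lhd> W' \<lhd> ass Z' Z U) \<cdot>
     (ass W W' ((Z' \<otimes> Z) \<otimes> U) \<cdot> ass (W \<otimes> W') (Z' \<otimes> Z) U) \<cdot> ass' (W \<otimes> W') (Z' \<otimes> Z) U"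
    by (subst pentagon) simp_all
  also have "\<dots> = eva e W Z U \<cdot> (W \<lhd> eva e' W' Z' (Z \<otimes> U)) \<cdot> ass W W' (Z' \<otimes> Z \<otimes> U) \<cdot> ((W \<otimes> W') \<lhd> ass Z' Z U)"
    by (simp add: ass_nat3)
  finally show ?thesis .
qed

lemma coeva_coevcomp:
  assumes "coevt c' Z' W'" "coevt c Z W" "src B Z' = trg B Z" "U \<in> Mor B" "trg B U = trg B Z'"
  shows "coeva (coevcomp c' W' Z' c W Z) (Z' \<otimes> Z) (W \<otimes> W') U
    = ((Z' \<otimes> Z) \<lhd> ass' W W' U) \<cdot> ass' Z' Z (W \<otimes> W' \<otimes> U) \<cdot> (Z' \<lhd> coeva c Z W (W' \<otimes> U)) \<cdot> coeva c' Z' W' U"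
proof -
  note [simp] = coevtD[OF assms(1)] coevtD[OF assms(2)] assms
  have eq: "ass Z' W' U \<cdot> (c' \<rhd> U) \<cdot> lu' U = coeva c' Z' W' U"
    by (simp add: coeva_def)
  have eq2: "ass Z (W \<otimes> W') U \<cdot> (coeva c Z W W' \<rhd> U) = (Z \<lhd> ass' W W' U) \<cdot> coeva c Z W (W' \<otimes> U)"
    by (simp add: coeva_rwh lwh_invs)
  have "coeva (coevcomp c' W' Z' c W Z) (Z' \<otimes> Z) (W \<otimes> W') U
      = ass (Z' \<otimes> Z) (W \<otimes> W') U \<cdot> (ass' Z' Z (W \<otimes> W') \<rhd> U) \<cdot> ((Z' \<lhd> coeva c Z W W') \<rhd> U) \<cdot> (c' \<rhd> U) \<cdot> lu' U"
    unfolding coeva_def[of "coevcomp c' W' Z' c W Z"] unfolding coevcomp_def by simp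
  also have "\<dots> = ass' Z' Z ((W \<otimes> W') \<otimes> U) \<cdot> (Z' \<lhd> (ass Z (W \<otimes> W') U \<cdot> (coeva c Z W W' \<rhd> U))) \<cdot> coeva c' Z' W' U"
    by (simp add: vcomp_chain[OF pentagon'] vcomp_chain[OF ass_nat2] eq)
  also have "\<dots> = ass' Z' Z ((W \<otimes> W') \<otimes> U) \<cdot> (Z' \<lhd> Z \<lhd> ass' W W' U) \<cdot> (Z' \<lhd> coeva c Z W (W' \<otimes> U)) \<cdot> coeva c' Z' W' U"
    by (simp add: eq2)
  also have "\<dots> = ((Z' \<otimes> Z) \<lhd> ass' W W' U) \<cdot> ass' Z' Z (W \<otimes> W' \<otimes> U) \<cdot> (Z' \<lhd> coeva c Z W (W' \<otimes> U)) \<cdot> coeva c' Z' W' U"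
    by (simp add: vcomp_chain[OF ass'_nat3])
  finally show ?thesis .
qed

text \<open>In each identity naturality separates the two adjunctions, and their zigzags then cancel
  one after the other.\<close>

lemma adj_comp:
  assumes "adj W' Z' e' c'" "adj W Z e c" "src B Z' = trg B Z"
  shows "adj (W \<otimes> W') (Z' \<otimes> Z) (evcomp e' W' Z' e W Z) (coevcomp c' W' Z' c W Z)"
proof -
  note [simp] = adjD[OF assms(1)] adjD[OF assms(2)] assms(3)
  have "((Z' \<otimes> Z) \<lhd> eva (evcomp e' W' Z' e W Z) (W \<otimes> W') (Z' \<otimes> Z) V) \<cdot>
      coeva (coevcomp c' W' Z' c W Z) (Z' \<otimes> Z) (W \<otimes> W') ((Z' \<otimes> Z) \<otimes> V) = id2 B ((Z' \<otimes> Z) \<otimes> V)"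
    if [simp]: "V \<in> Mor B" "trg B V = src B Z" for V
    by (simp add: eva_evcomp coeva_coevcomp eva_nats coeva_nats ass_nat3s ass'_nat3s lwh_invs
      adj_zz[OF assms(1)] adj_zz[OF assms(2)])
  moreover have "eva (evcomp e' W' Z' e W Z) (W \<otimes> W') (Z' \<otimes> Z) ((W \<otimes> W') \<otimes> U) \<cdot>
      ((W \<otimes> W') \<lhd> coeva (coevcomp c' W' Z' c W Z) (Z' \<otimes> Z) (W \<otimes> W') U) = id2 B ((W \<otimes> W') \<otimes> U)"
    if [simp]: "U \<in> Mor B" "trg B U = trg B Z'" for U
    by (simp add: eva_evcomp coeva_coevcomp eva_nats coeva_nats ass_nat3s ass'_nat3s lwh_invs
      adj_zz[OF assms(1)] adj_zz[OF assms(2)])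
  ultimately show ?thesis by (simp add: adj_def)
qed

end

subsection \<open>Pivotal bicategories\<close>

locale pivotal_bicat = bicat B for B :: "('o, 'm, 'c) pbicat" +
  assumes left_adjoints: "has_left_adjoints B" and pivotal: "pivotal_structure B"
begin

abbreviation "dg \<equiv> dag B"
abbreviation "pv \<equiv> piv B"
abbreviation "pv' X \<equiv> inv2 B (piv B X)"
abbreviation "EV X U \<equiv> eva (ev B X) (dg X) X U"
abbreviation "CV X U \<equiv> coeva (coev B X) X (dg X) U"
abbreviation "ET X U \<equiv> eva (ev_tilde B X) X (dg X) U"
abbreviation "CT X U \<equiv> coeva (coev_tilde B X) (dg X) X U"

lemma dag_type [simp]:
  assumes "X \<in> Mor B"
  shows "dg X \<in> Mor B" "src B (dg X) = trg B X" "trg B (dg X) = src B X"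
  using left_adjoints assms unfolding has_left_adjoints_def hom_def by auto

lemma ev_evt [simp]:
  assumes "X \<in> Mor B"
  shows "evt (ev B X) (dg X) X" "coevt (coev B X) X (dg X)"
  using left_adjoints assms unfolding has_left_adjoints_def hom_def hom2_def evt_def coevt_def by auto

text \<open>Whiskering the two axioms of \<open>has_left_adjoints\<close> with an arbitrary
  1-morphism turns them into zigzags of actions, by \<open>zigzag_rwh\<close> and
  \<open>transp_rwh\<close>.\<close>

lemma adj_dag [simp]:
  assumes X: "X \<in> Mor B"
  shows "adj (dg X) X (ev B X) (coev B X)"
proof -
  note [simp] = X evtD[OF ev_evt(1)[OF X]] coevtD[OF ev_evt(2)[OF X]]
  have 1: "ru X \<cdot> (X \<lhd> ev B X) \<cdot> ass X (dg X) X \<cdot> (coev B X \<rhd> X) \<cdot> lu' X = id2 B X"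
    using left_adjoints X unfolding has_left_adjoints_def lwh_def rwh_def by simp
  have 2: "transp (ev B X) (coev B X) (dg X) X (dg X) = id2 B (dg X)"
    using left_adjoints X unfolding has_left_adjoints_def transp_def lwh_def rwh_def by simp
  have "(X \<lhd> EV X V) \<cdot> CV X (X \<otimes> V) = id2 B (X \<otimes> V)" if "V \<in> Mor B" "trg B V = src B X" for V
    using zigzag_rwh[of "ev B X" "dg X" X "coev B X" V] that unfolding 1 by simp
  moreover have "EV X (dg X \<otimes> U) \<cdot> (dg X \<lhd> CV X U) = id2 B (dg X \<otimes> U)" if "U \<in> Mor B" "trg B U = trg B X" for U
    using transp_rwh[of "ev B X" "dg X" X "coev B X" "dg X" U] that unfolding 2 by simp
  ultimately show ?thesis unfolding adj_def by simp
qed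

lemma piv_type [simp]:
  assumes "X \<in> Mor B"
  shows "pv X \<in> Cell B" "dom2 B (pv X) = X" "cod2 B (pv X) = dg (dg X)"
    "pv' X \<in> Cell B" "dom2 B (pv' X) = dg (dg X)" "cod2 B (pv' X) = X"
    "pv' X \<cdot> pv X = id2 B X" "pv X \<cdot> pv' X = id2 B (dg (dg X))"
proof -
  have p: "pv X \<in> hom2 B X (dg (dg X))" and i: "iso2 B (pv X)"
    using pivotal assms unfolding pivotal_structure_def by auto
  show "pv X \<in> Cell B" "dom2 B (pv X) = X" "cod2 B (pv X) = dg (dg X)"
    "pv' X \<in> Cell B" "dom2 B (pv' X) = dg (dg X)" "cod2 B (pv' X) = X"
    "pv' X \<cdot> pv X = id2 B X" "pv X \<cdot> pv' X = id2 B (dg (dg X))"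
    using p inv2_props[OF i] by (auto simp: hom2_def)
qed

section \<open>The reversed adjunction given by \<open>ev_tilde\<close> and
  \<open>coev_tilde\<close>\<close>

lemma ev_tilde_rwh: "X \<in> Mor B \<Longrightarrow> ev_tilde B X = ev B (dg X) \<cdot> (pv X \<rhd> dg X)"
  by (simp add: ev_tilde_def rwh_def)

lemma coev_tilde_lwh: "X \<in> Mor B \<Longrightarrow> coev_tilde B X = (dg X \<lhd> pv' X) \<cdot> coev B (dg X)"
  by (simp add: coev_tilde_def lwh_def)

lemma tilde_evt [simp]:
  assumes "X \<in> Mor B"
  shows "evt (ev_tilde B X) X (dg X)" "coevt (coev_tilde B X) (dg X) X"
  using assms eva_precomp1(1)[of "ev B (dg X)" "dg (dg X)" "dg X" "pv X" X "I (trg B X)"]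
    coeva_postcomp2(1)[of "coev B (dg X)" "dg X" "dg (dg X)" "pv' X" X "I (src B X)"]
  by (simp_all add: ev_tilde_rwh coev_tilde_lwh)

lemma ET_eq:
  assumes "X \<in> Mor B" "U \<in> Mor B" "trg B U = trg B X"
  shows "ET X U = EV (dg X) U \<cdot> (pv X \<rhd> (dg X \<otimes> U))"
  using assms eva_precomp1(2)[of "ev B (dg X)" "dg (dg X)" "dg X" "pv X" X U] by (simp add: ev_tilde_rwh)

lemma CT_eq:
  assumes "X \<in> Mor B" "U \<in> Mor B" "trg B U = src B X"
  shows "CT X U = (dg X \<lhd> (pv' X \<rhd> U)) \<cdot> CV (dg X) U"
  using assms coeva_postcomp2(2)[of "coev B (dg X)" "dg X" "dg (dg X)" "pv' X" X U] by (simp add: coev_tilde_lwh)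

text \<open>The adjunction between \<open>dg (dg X)\<close> and \<open>dg X\<close>, transported
  along the isomorphism \<open>pv X\<close>: in each zigzag \<open>pv X\<close> and
  \<open>pv' X\<close> meet and cancel.\<close>

lemma adj_tilde [simp]:
  assumes [simp]: "X \<in> Mor B"
  shows "adj X (dg X) (ev_tilde B X) (coev_tilde B X)"
proof -
  have "(dg X \<lhd> ET X V) \<cdot> CT X (dg X \<otimes> V) = id2 B (dg X \<otimes> V)" if [simp]: "V \<in> Mor B" "trg B V = trg B X" for V
    by (simp add: ET_eq CT_eq rwh_inv lwh_invs adj_zz[OF adj_dag])
  moreover have "ET X (X \<otimes> U) \<cdot> (X \<lhd> CT X U) = id2 B (X \<otimes> U)" if [simp]: "U \<in> Mor B" "trg B U = src B X" for U
    by (simp add: ET_eq CT_eq interchanges eva_nats adj_zz[OF adj_dag] rwh_inv)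
  ultimately show ?thesis unfolding adj_def by simp
qed

section \<open>Mates and their sliding rules\<close>

lemma mate_eq:
  assumes "f \<in> Cell B" "dom2 B f = X" "cod2 B f = Y"
  shows "mate B f = transp (ev B Y) ((f \<rhd> dg X) \<cdot> coev B X) (dg Y) Y (dg X)"
  using assms by (simp add: mate_def transp_def lwh_def rwh_def Let_def)

text \<open>Before transposing, \<open>f\<close> can be attached to the coevaluation of its domain
  or to the evaluation of its codomain. \<open>mate\<close> does the former, and \<open>m2\<close>
  shows that the latter gives the same whiskered cell; \<open>transp_coeva\<close> and
  \<open>transp_eva\<close> then yield the two sliding rules.\<close>

lemma
  assumes "f \<in> Cell B" "dom2 B f = X" "cod2 B f = Y"
  shows mate_type [simp]: "mate B f \<in> Cell B" "dom2 B (mate B f) = dg Y" "cod2 B (mate B f) = dg X"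
    and mate_CV: "\<lbrakk>U \<in> Mor B; trg B U = trg B X\<rbrakk> \<Longrightarrow>
        (Y \<lhd> (mate B f \<rhd> U)) \<cdot> CV Y U = (f \<rhd> (dg X \<otimes> U)) \<cdot> CV X U"
    and mate_EV: "\<lbrakk>U \<in> Mor B; trg B U = src B X\<rbrakk> \<Longrightarrow>
        EV X U \<cdot> (mate B f \<rhd> (X \<otimes> U)) = EV Y U \<cdot> (dg Y \<lhd> (f \<rhd> U))"
proof -
  have t: "X \<in> Mor B" "Y \<in> Mor B" "src B Y = src B X" "trg B Y = trg B X"
    using assms cell_src_trg[of f] by auto
  note [simp] = assms t
  let ?c = "(f \<rhd> dg X) \<cdot> coev B X"
  let ?e = "ev B Y \<cdot> (dg Y \<lhd> f)"
  have c [simp]: "coevt ?c Y (dg X)"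
    using coeva_postcomp1(1)[of "coev B X" X "dg X" f Y "I (trg B X)"] by simp
  have e [simp]: "evt ?e (dg Y) X"
    using eva_precomp2(1)[of "ev B Y" "dg Y" Y f X "I (src B X)"] by simp
  have m: "mate B f = transp (ev B Y) ?c (dg Y) Y (dg X)" using assms by (rule mate_eq)
  show "mate B f \<in> Cell B" "dom2 B (mate B f) = dg Y" "cod2 B (mate B f) = dg X"
    unfolding m by simp_all
  show "(Y \<lhd> (mate B f \<rhd> U)) \<cdot> CV Y U = (f \<rhd> (dg X \<otimes> U)) \<cdot> CV X U" if [simp]: "U \<in> Mor B" "trg B U = trg B X" for U
    unfolding m by (subst transp_coeva) (simp_all add: coeva_postcomp1(2)[of "coev B X" X "dg X"])
  have m2: "mate B f \<rhd> U = transp ?e (coev B X) (dg Y) X (dg X) \<rhd> U" if [simp]: "U \<in> Mor B" "trg B U = trg B X" for U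
    unfolding m by (simp add: transp_rwh coeva_postcomp1(2)[of "coev B X" X "dg X"] eva_precomp2(2)[of "ev B Y" "dg Y" Y])
  show "EV X U \<cdot> (mate B f \<rhd> (X \<otimes> U)) = EV Y U \<cdot> (dg Y \<lhd> (f \<rhd> U))" if [simp]: "U \<in> Mor B" "trg B U = src B X" for U
    by (simp add: m2 transp_eva eva_precomp2(2)[of "ev B Y" "dg Y" Y])
qed

text \<open>Naturality of the pivotal structure moves \<open>f\<close> past \<open>pv\<close> as its
  double mate, and \<open>mate_EV\<close> slides one mate off onto the dual factor.\<close>

lemma ET_nat:
  assumes "f \<in> Cell B" "dom2 B f = P" "cod2 B f = Q" "U \<in> Mor B" "trg B U = trg B P"
  shows "ET Q U \<cdot> (f \<rhd> (dg Q \<otimes> U)) = ET P U \<cdot> (P \<lhd> (mate B f \<rhd> U))"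
proof -
  have t: "P \<in> Mor B" "Q \<in> Mor B" "src B Q = src B P" "trg B Q = trg B P"
    using assms cell_src_trg[of f] by auto
  note [simp] = assms t
  have n: "pv Q \<cdot> f = mate B (mate B f) \<cdot> pv P"
    using pivotal assms unfolding pivotal_structure_def by blast
  have "ET Q U \<cdot> (f \<rhd> (dg Q \<otimes> U)) = EV (dg Q) U \<cdot> ((pv Q \<cdot> f) \<rhd> (dg Q \<otimes> U))"
    by (simp add: ET_eq)
  also have "\<dots> = EV (dg Q) U \<cdot> (mate B (mate B f) \<rhd> (dg Q \<otimes> U)) \<cdot> (pv P \<rhd> (dg Q \<otimes> U))"
    unfolding n by simp
  also have "\<dots> = EV (dg P) U \<cdot> (dg (dg P) \<lhd> (mate B f \<rhd> U)) \<cdot> (pv P \<rhd> (dg Q \<otimes> U))"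
    by (simp add: vcomp_chain[OF mate_EV])
  also have "\<dots> = ET P U \<cdot> (P \<lhd> (mate B f \<rhd> U))"
    by (simp add: ET_eq interchange)
  finally show ?thesis .
qed

section \<open>The operators \<open>D_r\<close> and \<open>D_l\<close> in terms of actions\<close>

lemma D_r_enda:
  assumes "X \<in> Mor B" "endo p (src B X)"
  shows "endo (D_r B X p) (trg B X)"
    and "\<lbrakk>U \<in> Mor B; trg B U = trg B X\<rbrakk> \<Longrightarrow> enda (D_r B X p) U = ET X U \<cdot> (X \<lhd> enda p (dg X \<otimes> U)) \<cdot> CV X U"
proof -
  note [simp] = assms endoD[OF assms(2)]
  let ?h = "ru X \<cdot> (X \<lhd> p) \<cdot> ru' X"
  have D: "D_r B X p = ev_tilde B X \<cdot> (?h \<rhd> dg X) \<cdot> coev B X"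
    by (simp add: D_r_def lwh_def rwh_def)
  have c: "coevt ((?h \<rhd> dg X) \<cdot> coev B X) X (dg X)"
    using coeva_postcomp1(1)[of "coev B X" X "dg X" ?h X "I (trg B X)"] by simp
  show "endo (D_r B X p) (trg B X)"
    unfolding D using enda_eva_coeva(1)[OF tilde_evt(1) c, of "I (trg B X)"] by simp
  \<comment> \<open>\<open>D_r\<close> inserts \<open>p\<close> to the right of \<open>X\<close> by
    right unitors; after whiskering, the triangle identities turn these into the left unitors of
    \<open>enda\<close>.\<close>
  have h: "?h \<rhd> V = X \<lhd> enda p V" if [simp]: "V \<in> Mor B" "trg B V = src B X" for V
  proof -
    have "?h \<rhd> V = (X \<lhd> lu V) \<cdot> ass X (I (trg B V)) V \<cdot> ((X \<lhd> p) \<rhd> V) \<cdot> (ru' X \<rhd> V)"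
      using triangle[of V X] by (simp flip: vcomp_assoc)
    also have "\<dots> = (X \<lhd> lu V) \<cdot> (X \<lhd> (p \<rhd> V)) \<cdot> ass X (I (trg B V)) V \<cdot> (ru' X \<rhd> V)"
      by (simp add: vcomp_chain[OF ass_nat2])
    also have "\<dots> = X \<lhd> enda p V"
      using triangle'[of V X] by (simp add: enda_def)
    finally show ?thesis .
  qed
  show "enda (D_r B X p) U = ET X U \<cdot> (X \<lhd> enda p (dg X \<otimes> U)) \<cdot> CV X U" if [simp]: "U \<in> Mor B" "trg B U = trg B X"
  proof -
    have "enda (D_r B X p) U = ET X U \<cdot> coeva ((?h \<rhd> dg X) \<cdot> coev B X) X (dg X) U"
      unfolding D using enda_eva_coeva(2)[OF tilde_evt(1) c, of U] by simp
    also have "\<dots> = ET X U \<cdot> (?h \<rhd> (dg X \<otimes> U)) \<cdot> CV X U"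
      using coeva_postcomp1(2)[of "coev B X" X "dg X" ?h X U] by simp
    also have "\<dots> = ET X U \<cdot> (X \<lhd> enda p (dg X \<otimes> U)) \<cdot> CV X U"
      by (subst h) simp_all
    finally show ?thesis .
  qed
qed

text \<open>Here \<open>p\<close> stands to the left of \<open>X\<close>, so the inserted cell is
  already \<open>enda p X\<close>, and \<open>enda_rwh\<close> extends it to
  \<open>X \<otimes> U\<close>.\<close>

lemma D_l_enda:
  assumes "X \<in> Mor B" "endo p (trg B X)"
  shows "endo (D_l B X p) (src B X)"
    and "\<lbrakk>U \<in> Mor B; trg B U = src B X\<rbrakk> \<Longrightarrow> enda (D_l B X p) U = EV X U \<cdot> (dg X \<lhd> enda p (X \<otimes> U)) \<cdot> CT X U"
proof -
  note [simp] = assms endoD[OF assms(2)]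
  have D: "D_l B X p = ev B X \<cdot> (dg X \<lhd> enda p X) \<cdot> coev_tilde B X"
    by (simp add: D_l_def lwh_def rwh_def enda_def)
  have c: "coevt ((dg X \<lhd> enda p X) \<cdot> coev_tilde B X) (dg X) X"
    using coeva_postcomp2(1)[of "coev_tilde B X" "dg X" X "enda p X" X "I (src B X)"] by simp
  show "endo (D_l B X p) (src B X)"
    unfolding D using enda_eva_coeva(1)[OF ev_evt(1) c, of "I (src B X)"] by simp
  show "enda (D_l B X p) U = EV X U \<cdot> (dg X \<lhd> enda p (X \<otimes> U)) \<cdot> CT X U" if [simp]: "U \<in> Mor B" "trg B U = src B X"
    unfolding D using enda_eva_coeva(2)[OF ev_evt(1) c, of U]
      coeva_postcomp2(2)[of "coev_tilde B X" "dg X" X "enda p X" X U]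
    by (simp add: enda_rwh)
qed

subsection \<open>Composites\<close>

lemma ev_comp_eq:
  assumes [simp]: "X \<in> Mor B" "Y \<in> Mor B" "src B Y = trg B X"
  shows "ev_comp B Y X = evcomp (ev B Y) (dg Y) Y (ev B X) (dg X) X"
proof -
  note [simp] = evtD[OF ev_evt(1)]
  show ?thesis by (simp add: ev_comp_def evcomp_def eva_def flip: lwh_def rwh_def)
qed

lemma dag_comp_iso_eq:
  assumes "X \<in> Mor B" "Y \<in> Mor B" "src B Y = trg B X"
  shows "dag_comp_iso B Y X = transp (evcomp (ev B Y) (dg Y) Y (ev B X) (dg X) X)
    (coev B (Y \<otimes> X)) (dg X \<otimes> dg Y) (Y \<otimes> X) (dg (Y \<otimes> X))"
  using assms by (simp add: dag_comp_iso_def transp_def ev_comp_eq Let_def lwh_def rwh_def)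

text \<open>\<open>dag_comp_iso\<close> compares two left adjoints of \<open>Y \<otimes> X\<close>:
  the composite one of \<open>adj_comp\<close> and the chosen one. Invertibility and both
  compatibilities are instances of the general facts on \<open>transp\<close>.\<close>

lemma
  assumes [simp]: "X \<in> Mor B" "Y \<in> Mor B" "src B Y = trg B X"
  shows dag_comp_iso_type [simp]: "dag_comp_iso B Y X \<in> Cell B"
      "dom2 B (dag_comp_iso B Y X) = dg X \<otimes> dg Y" "cod2 B (dag_comp_iso B Y X) = dg (Y \<otimes> X)"
      "inv2 B (dag_comp_iso B Y X) \<in> Cell B"
      "dom2 B (inv2 B (dag_comp_iso B Y X)) = dg (Y \<otimes> X)"
      "cod2 B (inv2 B (dag_comp_iso B Y X)) = dg X \<otimes> dg Y"
      "inv2 B (dag_comp_iso B Y X) \<cdot> dag_comp_iso B Y X = id2 B (dg X \<otimes> dg Y)"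
      "dag_comp_iso B Y X \<cdot> inv2 B (dag_comp_iso B Y X) = id2 B (dg (Y \<otimes> X))"
    and dag_comp_iso_iso: "iso2 B (dag_comp_iso B Y X)"
    and dag_comp_iso_EV: "\<lbrakk>U \<in> Mor B; trg B U = src B X\<rbrakk> \<Longrightarrow>
      EV (Y \<otimes> X) U \<cdot> (dag_comp_iso B Y X \<rhd> ((Y \<otimes> X) \<otimes> U)) = EV X U \<cdot> (dg X \<lhd> EV Y (X \<otimes> U)) \<cdot>
        ass (dg X) (dg Y) (Y \<otimes> X \<otimes> U) \<cdot> ((dg X \<otimes> dg Y) \<lhd> ass Y X U)"
    and CV_comp: "\<lbrakk>U \<in> Mor B; trg B U = trg B Y\<rbrakk> \<Longrightarrow>
      CV (Y \<otimes> X) U = ((Y \<otimes> X) \<lhd> (dag_comp_iso B Y X \<rhd> U)) \<cdot> ((Y \<otimes> X) \<lhd> ass' (dg X) (dg Y) U) \<cdot>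
        ass' Y X (dg X \<otimes> dg Y \<otimes> U) \<cdot> (Y \<lhd> CV X (dg Y \<otimes> U)) \<cdot> CV Y U"
proof -
  let ?e = "evcomp (ev B Y) (dg Y) Y (ev B X) (dg X) X"
  let ?c = "coevcomp (coev B Y) (dg Y) Y (coev B X) (dg X) X"
  let ?W = "dg X \<otimes> dg Y" and ?Z = "Y \<otimes> X"
  have adj: "adj ?W ?Z ?e ?c" by (rule adj_comp) simp_all
  note eq = dag_comp_iso_eq[OF assms]
  note [simp] = adjD[OF adj]
  show t: "dag_comp_iso B Y X \<in> Cell B"
      "dom2 B (dag_comp_iso B Y X) = dg X \<otimes> dg Y" "cod2 B (dag_comp_iso B Y X) = dg (Y \<otimes> X)"
    unfolding eq by simp_all
  \<comment> \<open>The inverse is the transpose in the opposite direction.\<close>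
  show iso: "iso2 B (dag_comp_iso B Y X)"
    unfolding eq by (rule iso2I[of _ "transp (ev B ?Z) ?c (dg ?Z) ?Z ?W"])
      (simp_all add: transp_inverse[OF adj adj_dag] transp_inverse[OF adj_dag adj])
  show "inv2 B (dag_comp_iso B Y X) \<in> Cell B"
      "dom2 B (inv2 B (dag_comp_iso B Y X)) = dg (Y \<otimes> X)"
      "cod2 B (inv2 B (dag_comp_iso B Y X)) = dg X \<otimes> dg Y"
      "inv2 B (dag_comp_iso B Y X) \<cdot> dag_comp_iso B Y X = id2 B (dg X \<otimes> dg Y)"
      "dag_comp_iso B Y X \<cdot> inv2 B (dag_comp_iso B Y X) = id2 B (dg (Y \<otimes> X))"
    using inv2_props[OF iso] t by simp_all
  show "EV ?Z U \<cdot> (dag_comp_iso B Y X \<rhd> (?Z \<otimes> U)) = EV X U \<cdot> (dg X \<lhd> EV Y (X \<otimes> U)) \<cdot>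
        ass (dg X) (dg Y) (Y \<otimes> X \<otimes> U) \<cdot> ((dg X \<otimes> dg Y) \<lhd> ass Y X U)"
    if [simp]: "U \<in> Mor B" "trg B U = src B X" for U
    unfolding eq by (simp add: transp_eva eva_evcomp)
  show "CV ?Z U = (?Z \<lhd> (dag_comp_iso B Y X \<rhd> U)) \<cdot> (?Z \<lhd> ass' (dg X) (dg Y) U) \<cdot>
        ass' Y X (dg X \<otimes> dg Y \<otimes> U) \<cdot> (Y \<lhd> CV X (dg Y \<otimes> U)) \<cdot> CV Y U"
    if [simp]: "U \<in> Mor B" "trg B U = trg B Y" for U
    using transp_coeva[OF adj ev_evt(2)[of ?Z], of U] unfolding eq by (simp add: coeva_coevcomp)
qed

text \<open>This is where compatibility of the pivotal structure with \<otimes> enters. It writes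
  \<open>pv ?Z\<close> as \<open>?H\<close> followed by \<open>?j\<close> and the mate of
  \<open>?i\<close>: the mate slides over to the dual factor as \<open>?i\<close>, \<open>?j\<close>
  splits the evaluation into two nested ones, and \<open>?H\<close> supplies their pivotal
  cells.\<close>

lemma ET_comp:
  assumes [simp]: "X \<in> Mor B" "Y \<in> Mor B" "src B Y = trg B X" "U \<in> Mor B" "trg B U = trg B Y"
  shows "ET (Y \<otimes> X) U = ET Y U \<cdot> (Y \<lhd> ET X (dg Y \<otimes> U)) \<cdot>
    (Y \<lhd> X \<lhd> (ass (dg X) (dg Y) U \<cdot> (inv2 B (dag_comp_iso B Y X) \<rhd> U))) \<cdot> ass Y X (dg (Y \<otimes> X) \<otimes> U)"
proof -
  let ?Z = "Y \<otimes> X" and ?W = "dg X \<otimes> dg Y" and ?i = "inv2 B (dag_comp_iso B Y X)"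
  let ?j = "dag_comp_iso B (dg X) (dg Y)" and ?V = "dg (dg Y) \<otimes> dg (dg X)"
  let ?T = "dg ?Z \<otimes> U"
  let ?H = "hcomp2 B (pv Y) (pv X)"
  have H: "?H = (pv Y \<rhd> dg (dg X)) \<cdot> (Y \<lhd> pv X)" by (simp add: hcomp2_eq_rl)
  have "pv ?Z = (mate B ?i \<cdot> ?j) \<cdot> ?H"
    using pivotal assms unfolding pivotal_structure_def ddag_comp_iso_def by blast
  then have p: "pv ?Z = mate B ?i \<cdot> ?j \<cdot> ?H" by simp
  have "ET ?Z U = (EV (dg ?Z) U \<cdot> (mate B ?i \<rhd> ?T)) \<cdot> (?j \<rhd> ?T) \<cdot> (?H \<rhd> ?T)"
    by (simp add: ET_eq p)
  also have "\<dots> = EV ?W U \<cdot> (dg ?W \<lhd> (?i \<rhd> U)) \<cdot> (?j \<rhd> ?T) \<cdot> (?H \<rhd> ?T)"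
    by (subst mate_EV[of ?i "dg ?Z" ?W]) simp_all
  also have "\<dots> = (EV ?W U \<cdot> (?j \<rhd> (?W \<otimes> U))) \<cdot> (?V \<lhd> (?i \<rhd> U)) \<cdot> (?H \<rhd> ?T)"
    by (simp add: interchanges)
  also have "\<dots> = EV (dg Y) U \<cdot> (dg (dg Y) \<lhd> EV (dg X) (dg Y \<otimes> U)) \<cdot>
      ass (dg (dg Y)) (dg (dg X)) (dg X \<otimes> dg Y \<otimes> U) \<cdot> (?V \<lhd> ass (dg X) (dg Y) U) \<cdot> (?V \<lhd> (?i \<rhd> U)) \<cdot> (?H \<rhd> ?T)"
    by (subst dag_comp_iso_EV) simp_all
  also have "\<dots> = EV (dg Y) U \<cdot> (dg (dg Y) \<lhd> EV (dg X) (dg Y \<otimes> U)) \<cdot>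
      (dg (dg Y) \<lhd> dg (dg X) \<lhd> (ass (dg X) (dg Y) U \<cdot> (?i \<rhd> U))) \<cdot>
      (pv Y \<rhd> (dg (dg X) \<otimes> ?T)) \<cdot> (Y \<lhd> (pv X \<rhd> ?T)) \<cdot> ass Y X ?T"
    by (simp add: H ass_nat3s vcomp_chain[OF ass_nat1] ass_nat2 vcomp_chain[OF ass_nat2])
  also have "\<dots> = ET Y U \<cdot> (Y \<lhd> ET X (dg Y \<otimes> U)) \<cdot>
      (Y \<lhd> X \<lhd> (ass (dg X) (dg Y) U \<cdot> (?i \<rhd> U))) \<cdot> ass Y X ?T"
    by (simp add: ET_eq interchanges)
  finally show ?thesis .
qed

section \<open>Multiplicativity of \<open>D_r\<close> and invariance under isomorphism\<close>

lemma enda_nat_lwh: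
  assumes "endo p (trg B (dom2 B g))" "g \<in> Cell B" "cod2 B g = V" "W \<in> Mor B" "src B W = trg B (dom2 B g)"
  shows "(W \<lhd> enda p V) \<cdot> (W \<lhd> g) = (W \<lhd> g) \<cdot> (W \<lhd> enda p (dom2 B g))"
  using enda_nat[OF assms(1-3)] lwh_vcomp[of g "enda p V" W] lwh_vcomp[of "enda p (dom2 B g)" g W]
    cod2_props[OF assms(2,3)] assms by simp

text \<open>A loop labelled \<open>Y \<otimes> X\<close> is a loop labelled \<open>X\<close> inside
  one labelled \<open>Y\<close>. The comparison cells \<open>?h\<close> from \<open>ET_comp\<close>
  and \<open>?g\<close> from \<open>CV_comp\<close> compose to the identity, and they cancel across
  \<open>p\<close> because \<open>enda p\<close> is natural.\<close>

lemma D_r_comp: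
  assumes [simp]: "X \<in> Mor B" "Y \<in> Mor B" "src B Y = trg B X" and p [simp]: "endo p (src B X)"
  shows "D_r B (Y \<otimes> X) p = D_r B Y (D_r B X p)"
proof (rule enda_faithful)
  have [simp]: "endo (D_r B X p) (trg B X)" by (simp add: D_r_enda)
  show "endo (D_r B (Y \<otimes> X) p) (trg B Y)" "endo (D_r B Y (D_r B X p)) (trg B Y)"
    using D_r_enda(1)[of "Y \<otimes> X" p] by (simp_all add: D_r_enda)
  fix U assume [simp]: "U \<in> Mor B" "trg B U = trg B Y"
  let ?Z = "Y \<otimes> X" and ?f = "dag_comp_iso B Y X"
  let ?i = "inv2 B ?f" and ?W = "dg X \<otimes> dg Y"
  let ?E = "ET Y U \<cdot> (Y \<lhd> ET X (dg Y \<otimes> U))" and ?C = "(Y \<lhd> CV X (dg Y \<otimes> U)) \<cdot> CV Y U"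
  let ?g = "(?f \<rhd> U) \<cdot> ass' (dg X) (dg Y) U" and ?h = "ass (dg X) (dg Y) U \<cdot> (?i \<rhd> U)"
  have hg: "?h \<cdot> ?g = id2 B (dg X \<otimes> dg Y \<otimes> U)"
    by (simp add: vcomp_chain[OF rwh_inv])
  have "enda p (dg ?Z \<otimes> U) \<cdot> ?g = ?g \<cdot> enda p (dg X \<otimes> dg Y \<otimes> U)"
    by (subst enda_nat) simp_all
  then have "?h \<cdot> enda p (dg ?Z \<otimes> U) \<cdot> ?g = (?h \<cdot> ?g) \<cdot> enda p (dg X \<otimes> dg Y \<otimes> U)"
    by simp
  then have mid: "?h \<cdot> enda p (dg ?Z \<otimes> U) \<cdot> ?g = enda p (dg X \<otimes> dg Y \<otimes> U)"
    unfolding hg by simp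
  have "enda (D_r B ?Z p) U = ET ?Z U \<cdot> (?Z \<lhd> enda p (dg ?Z \<otimes> U)) \<cdot> CV ?Z U"
    by (simp add: D_r_enda)
  also have "\<dots> = ?E \<cdot> (Y \<lhd> X \<lhd> ?h) \<cdot> ass Y X (dg ?Z \<otimes> U) \<cdot> (?Z \<lhd> (enda p (dg ?Z \<otimes> U) \<cdot> ?g)) \<cdot>
      ass' Y X (dg X \<otimes> dg Y \<otimes> U) \<cdot> ?C"
    by (simp add: ET_comp CV_comp)
  also have "\<dots> = ?E \<cdot> (Y \<lhd> X \<lhd> (?h \<cdot> enda p (dg ?Z \<otimes> U) \<cdot> ?g)) \<cdot> ?C"
    by (simp add: ass_nat3s)
  also have "\<dots> = ?E \<cdot> (Y \<lhd> X \<lhd> enda p (dg X \<otimes> dg Y \<otimes> U)) \<cdot> ?C"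
    unfolding mid ..
  also have "\<dots> = enda (D_r B Y (D_r B X p)) U"
    by (simp add: D_r_enda)
  finally show "enda (D_r B ?Z p) U = enda (D_r B Y (D_r B X p)) U" .
qed

text \<open>Insert \<open>g \<cdot> f\<close> at the coevaluation. Then \<open>f\<close> travels
  around the loop: it slides to the dual factor as its mate, passes \<open>p\<close> by naturality,
  returns to the first factor by \<open>ET_nat\<close>, and cancels against
  \<open>g\<close>.\<close>

lemma D_r_iso:
  assumes "f \<in> Cell B" "dom2 B f = P" "cod2 B f = Q" "g \<in> Cell B" "dom2 B g = Q" "cod2 B g = P"
    "f \<cdot> g = id2 B Q" "g \<cdot> f = id2 B P" "endo p (src B P)"
  shows "D_r B P p = D_r B Q p"
proof -
  have t: "P \<in> Mor B" "Q \<in> Mor B" "src B Q = src B P" "trg B Q = trg B P"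
    using assms cell_src_trg[of f] by auto
  note [simp] = assms t
  show ?thesis
  proof (rule enda_faithful)
    show "endo (D_r B P p) (trg B P)" "endo (D_r B Q p) (trg B P)"
      using D_r_enda(1)[of Q p] by (simp_all add: D_r_enda)
    fix U assume [simp]: "U \<in> Mor B" "trg B U = trg B P"
    let ?m = "mate B f \<rhd> U"
    have "CV P U = (g \<rhd> (dg P \<otimes> U)) \<cdot> (f \<rhd> (dg P \<otimes> U)) \<cdot> CV P U"
      by (simp add: vcomp_chain[OF rwh_inv])
    also have "\<dots> = (g \<rhd> (dg P \<otimes> U)) \<cdot> (Q \<lhd> ?m) \<cdot> CV Q U"
      by (simp add: mate_CV)
    finally have C: "CV P U = (P \<lhd> ?m) \<cdot> (g \<rhd> (dg Q \<otimes> U)) \<cdot> CV Q U"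
      by (simp add: interchanges)
    have "enda (D_r B P p) U = ET P U \<cdot> (P \<lhd> enda p (dg P \<otimes> U)) \<cdot> (P \<lhd> ?m) \<cdot> (g \<rhd> (dg Q \<otimes> U)) \<cdot> CV Q U"
      using C by (simp add: D_r_enda)
    also have "\<dots> = (ET P U \<cdot> (P \<lhd> ?m)) \<cdot> (P \<lhd> enda p (dg Q \<otimes> U)) \<cdot> (g \<rhd> (dg Q \<otimes> U)) \<cdot> CV Q U"
      by (simp add: vcomp_chain[OF enda_nat_lwh])
    also have "\<dots> = ET Q U \<cdot> (f \<rhd> (dg Q \<otimes> U)) \<cdot> (P \<lhd> enda p (dg Q \<otimes> U)) \<cdot> (g \<rhd> (dg Q \<otimes> U)) \<cdot> CV Q U"
      by (simp add: ET_nat[of f P Q, symmetric])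
    also have "\<dots> = enda (D_r B Q p) U"
      by (simp add: interchanges D_r_enda vcomp_chain[OF rwh_inv])
    finally show "enda (D_r B P p) U = enda (D_r B Q p) U" .
  qed
qed

subsection \<open>Units\<close>

lemma lu_nat':
  assumes "f \<in> Cell B" "dom2 B f = X" "trg B X = b"
  shows "f \<cdot> lu X = lu (cod2 B f) \<cdot> (I b \<lhd> f)"
  using lu_nat[of f] assms by simp

lemma lu'_nat':
  assumes "f \<in> Cell B" "dom2 B f = X" "trg B X = b"
  shows "(I b \<lhd> f) \<cdot> lu' X = lu' (cod2 B f) \<cdot> f"
  using lu'_nat[of f] assms by simp

text \<open>With the factor \<open>I a\<close> removed by unitors, the adjunction data of the unit
  trivialise its dual. \<open>ku\<close>, \<open>ku'\<close> come from \<open>EV\<close>,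
  \<open>CV\<close>, and \<open>kt\<close>, \<open>kt'\<close> from \<open>ET\<close>,
  \<open>CT\<close>; triviality of \<open>D_r B (I a)\<close> will follow from the agreement of
  \<open>kt\<close> with \<open>ku\<close>.\<close>

definition ku :: "'o \<Rightarrow> 'm \<Rightarrow> 'c" where
  "ku a U = EV (I a) U \<cdot> (dg (I a) \<lhd> lu' U)"

definition ku' :: "'o \<Rightarrow> 'm \<Rightarrow> 'c" where
  "ku' a U = lu (dg (I a) \<otimes> U) \<cdot> CV (I a) U"

definition kt :: "'o \<Rightarrow> 'm \<Rightarrow> 'c" where
  "kt a U = ET (I a) U \<cdot> lu' (dg (I a) \<otimes> U)"

definition kt' :: "'o \<Rightarrow> 'm \<Rightarrow> 'c" where
  "kt' a U = (dg (I a) \<lhd> lu U) \<cdot> CT (I a) U"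

context
  fixes a assumes a [simp]: "a \<in> Obj B"
begin

abbreviation "J \<equiv> dg (I a)"

lemma ku_type [simp]:
  assumes "U \<in> Mor B" "trg B U = a"
  shows "ku a U \<in> Cell B" "dom2 B (ku a U) = J \<otimes> U" "cod2 B (ku a U) = U"
    "ku' a U \<in> Cell B" "dom2 B (ku' a U) = U" "cod2 B (ku' a U) = J \<otimes> U"
    "kt a U \<in> Cell B" "dom2 B (kt a U) = J \<otimes> U" "cod2 B (kt a U) = U"
    "kt' a U \<in> Cell B" "dom2 B (kt' a U) = U" "cod2 B (kt' a U) = J \<otimes> U"
  using assms by (simp_all add: ku_def ku'_def kt_def kt'_def)

lemma EV_unit: "\<lbrakk>U \<in> Mor B; trg B U = a\<rbrakk> \<Longrightarrow> EV (I a) U = ku a U \<cdot> (J \<lhd> lu U)"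
  by (simp add: ku_def lwh_invs)

lemma CV_unit: "\<lbrakk>U \<in> Mor B; trg B U = a\<rbrakk> \<Longrightarrow> CV (I a) U = lu' (J \<otimes> U) \<cdot> ku' a U"
  by (simp add: ku'_def)

lemma ET_unit: "\<lbrakk>U \<in> Mor B; trg B U = a\<rbrakk> \<Longrightarrow> ET (I a) U = kt a U \<cdot> lu (J \<otimes> U)"
  by (simp add: kt_def)

lemma CT_unit: "\<lbrakk>U \<in> Mor B; trg B U = a\<rbrakk> \<Longrightarrow> CT (I a) U = (J \<lhd> lu' U) \<cdot> kt' a U"
  by (simp add: kt'_def lwh_invs)

lemma ku_nat:
  assumes "g \<in> Cell B" "trg B (dom2 B g) = a" "cod2 B g = V"
  shows "ku a V \<cdot> (J \<lhd> g) = g \<cdot> ku a (dom2 B g)"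
proof -
  note [simp] = assms cod2_props[OF assms(1,3)]
  have "ku a V \<cdot> (J \<lhd> g) = EV (I a) V \<cdot> (J \<lhd> (lu' V \<cdot> g))"
    by (simp add: ku_def)
  also have "lu' V \<cdot> g = (I a \<lhd> g) \<cdot> lu' (dom2 B g)"
    by (simp add: lu'_nat)
  finally show ?thesis by (simp add: ku_def eva_nats)
qed

lemma kt_nat:
  assumes "g \<in> Cell B" "trg B (dom2 B g) = a" "cod2 B g = V"
  shows "kt a V \<cdot> (J \<lhd> g) = g \<cdot> kt a (dom2 B g)"
proof -
  note [simp] = assms cod2_props[OF assms(1,3)]
  have "kt a V \<cdot> (J \<lhd> g) = ET (I a) V \<cdot> (lu' (J \<otimes> V) \<cdot> (J \<lhd> g))"
    by (simp add: kt_def)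
  also have "lu' (J \<otimes> V) \<cdot> (J \<lhd> g) = (I a \<lhd> J \<lhd> g) \<cdot> lu' (J \<otimes> dom2 B g)"
    by (simp add: lu'_nat)
  finally show ?thesis by (simp add: kt_def eva_nats)
qed

lemma kt'_nat:
  assumes "g \<in> Cell B" "trg B (dom2 B g) = a" "cod2 B g = V"
  shows "(J \<lhd> g) \<cdot> kt' a (dom2 B g) = kt' a V \<cdot> g"
proof -
  note [simp] = assms cod2_props[OF assms(1,3)]
  have "kt' a V \<cdot> g = (J \<lhd> lu V) \<cdot> (J \<lhd> I a \<lhd> g) \<cdot> CT (I a) (dom2 B g)"
    by (simp add: kt'_def coeva_nat)
  also have "\<dots> = (J \<lhd> (lu V \<cdot> (I a \<lhd> g))) \<cdot> CT (I a) (dom2 B g)"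
    by simp
  also have "lu V \<cdot> (I a \<lhd> g) = g \<cdot> lu (dom2 B g)"
    by (simp add: lu_nat)
  finally show ?thesis by (simp add: kt'_def)
qed

text \<open>For the first composite, naturality of the left unitor makes \<open>EV\<close> and
  \<open>CV\<close> adjacent. For the second, naturality of \<open>ku\<close> at the cell
  \<open>ku' a U\<close> exchanges the two factors. Each then reduces to one zigzag for
  \<open>I a\<close>.\<close>

lemma ku_inv [simp]:
  assumes [simp]: "U \<in> Mor B" "trg B U = a"
  shows "ku a U \<cdot> ku' a U = id2 B U" "ku' a U \<cdot> ku a U = id2 B (J \<otimes> U)"
proof -
  have "ku a U \<cdot> ku' a U = EV (I a) U \<cdot> ((J \<lhd> lu' U) \<cdot> lu (J \<otimes> U)) \<cdot> CV (I a) U"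
    by (simp add: ku_def ku'_def)
  also have "(J \<lhd> lu' U) \<cdot> lu (J \<otimes> U) = lu (J \<otimes> I a \<otimes> U) \<cdot> (I a \<lhd> J \<lhd> lu' U)"
    by (simp add: lu_nat')
  also have "EV (I a) U \<cdot> (lu (J \<otimes> I a \<otimes> U) \<cdot> (I a \<lhd> J \<lhd> lu' U)) \<cdot> CV (I a) U
      = (EV (I a) U \<cdot> lu (J \<otimes> I a \<otimes> U)) \<cdot> CV (I a) (I a \<otimes> U) \<cdot> lu' U"
    by (simp add: coeva_nats)
  also have "EV (I a) U \<cdot> lu (J \<otimes> I a \<otimes> U) = lu U \<cdot> (I a \<lhd> EV (I a) U)"
    by (simp add: lu_nat')
  finally show "ku a U \<cdot> ku' a U = id2 B U"
    by (simp add: adj_zz[OF adj_dag])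
  have "ku' a U \<cdot> ku a U = ku a (J \<otimes> U) \<cdot> (J \<lhd> ku' a U)"
    by (simp add: ku_nat)
  also have "\<dots> = id2 B (J \<otimes> U)"
    by (simp add: ku_def ku'_def lwh_invs adj_zz[OF adj_dag])
  finally show "ku' a U \<cdot> ku a U = id2 B (J \<otimes> U)" .
qed

lemma kt_inv [simp]:
  assumes [simp]: "U \<in> Mor B" "trg B U = a"
  shows "kt a U \<cdot> kt' a U = id2 B U" "kt' a U \<cdot> kt a U = id2 B (J \<otimes> U)"
proof -
  have "kt a U \<cdot> kt' a U = lu U \<cdot> kt a (I a \<otimes> U) \<cdot> CT (I a) U"
    by (simp add: kt'_def vcomp_chain[OF kt_nat])
  also have "\<dots> = lu U \<cdot> ET (I a) (I a \<otimes> U) \<cdot> (lu' (J \<otimes> I a \<otimes> U) \<cdot> CT (I a) U)"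
    by (simp add: kt_def)
  also have "lu' (J \<otimes> I a \<otimes> U) \<cdot> CT (I a) U = (I a \<lhd> CT (I a) U) \<cdot> lu' U"
    by (simp add: lu'_nat)
  finally show "kt a U \<cdot> kt' a U = id2 B U"
    by (simp add: adj_zz[OF adj_tilde])
  have "kt' a U \<cdot> kt a U = (J \<lhd> kt a U) \<cdot> kt' a (J \<otimes> U)"
    using kt'_nat[of "kt a U" U] by simp
  also have "\<dots> = id2 B (J \<otimes> U)"
    by (simp add: kt_def kt'_def lwh_invs adj_zz[OF adj_tilde])
  finally show "kt' a U \<cdot> kt a U = id2 B (J \<otimes> U)" .
qed

text \<open>Compatibility of the pivotal structure with units is not an axiom: it follows from
  compatibility with \<open>I \<otimes> I\<close>, because an invertible idempotent is the identity.\<close>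

lemma kt_eq_ku:
  assumes [simp]: "U \<in> Mor B" "trg B U = a"
  shows "kt a U = ku a U"
proof -
  let ?I = "I a"
  let ?f = "dag_comp_iso B ?I ?I" and ?m = "mate B (lu ?I)"
  \<comment> \<open>\<open>G\<close> is the mate of the unitor from \<open>?I \<otimes> ?I\<close>
    to \<open>?I\<close>, with the dual of \<open>?I \<otimes> ?I\<close> replaced by
    \<open>J \<otimes> J\<close> through \<open>?f\<close>.\<close>
  define G where "G V = ass J J V \<cdot> (inv2 B ?f \<rhd> V) \<cdot> (?m \<rhd> V)" for V
  have [simp]: "?m \<in> Cell B" "dom2 B ?m = J" "cod2 B ?m = dg (?I \<otimes> ?I)"
    using mate_type[of "lu ?I" "?I \<otimes> ?I" ?I] by simp_all
  have G [simp]: "G V \<in> Cell B" "dom2 B (G V) = J \<otimes> V" "cod2 B (G V) = J \<otimes> J \<otimes> V"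
    if "V \<in> Mor B" "trg B V = a" for V
    using that by (simp_all add: G_def)
  have G_nat: "(J \<lhd> J \<lhd> g) \<cdot> G (dom2 B g) = G (cod2 B g) \<cdot> (J \<lhd> g)" if [simp]: "g \<in> Cell B" "trg B (dom2 B g) = a" for g
    by (simp add: G_def interchanges vcomp_chain[OF ass_nat3])
  have m: "?m \<rhd> V = (?f \<rhd> V) \<cdot> ass' J J V \<cdot> G V" if [simp]: "V \<in> Mor B" "trg B V = a" for V
    by (simp add: G_def vcomp_chain[OF rwh_inv])
  have lu2: "lu ?I \<rhd> V = lu (?I \<otimes> V) \<cdot> ass ?I ?I V" if [simp]: "V \<in> Mor B" "trg B V = a" for V
    using lu_hcomp[of V ?I] by simp
  let ?II = "(?I \<otimes> ?I) \<otimes> U"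
  let ?l = "lu U \<cdot> (lu ?I \<rhd> U)" and ?l' = "ass' ?I ?I U \<cdot> lu' (?I \<otimes> U) \<cdot> lu' U"
  \<comment> \<open>\<open>mate_EV\<close> at \<open>lu ?I\<close> determines \<open>G U\<close>:
    once the invertible cells \<open>ku\<close> and \<open>?l\<close> are cancelled, it must be
    \<open>J \<lhd> ku' a U\<close>.\<close>
  have "ku a U \<cdot> (J \<lhd> ?l) = EV ?I U \<cdot> (J \<lhd> (lu ?I \<rhd> U))"
    by (simp add: EV_unit)
  also have "\<dots> = EV (?I \<otimes> ?I) U \<cdot> (?m \<rhd> ?II)"
    using mate_EV[of "lu ?I" "?I \<otimes> ?I" ?I U] by simp
  also have "\<dots> = (EV (?I \<otimes> ?I) U \<cdot> (?f \<rhd> ?II)) \<cdot> ass' J J ?II \<cdot> G ?II"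
    by (simp add: m)
  also have "\<dots> = EV ?I U \<cdot> (J \<lhd> EV ?I (?I \<otimes> U)) \<cdot> (J \<lhd> J \<lhd> ass ?I ?I U) \<cdot> G ?II"
    by (subst dag_comp_iso_EV) (simp_all add: ass_nat3s)
  also have "\<dots> = ku a U \<cdot> (J \<lhd> (lu U \<cdot> ku a (?I \<otimes> U))) \<cdot> (J \<lhd> J \<lhd> (lu (?I \<otimes> U) \<cdot> ass ?I ?I U)) \<cdot> G ?II"
    by (simp add: EV_unit)
  also have "lu U \<cdot> ku a (?I \<otimes> U) = ku a U \<cdot> (J \<lhd> lu U)"
    by (simp add: ku_nat)
  also have "ku a U \<cdot> (J \<lhd> (ku a U \<cdot> (J \<lhd> lu U))) \<cdot> (J \<lhd> J \<lhd> (lu (?I \<otimes> U) \<cdot> ass ?I ?I U)) \<cdot> G ?II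
      = ku a U \<cdot> (J \<lhd> ku a U) \<cdot> (J \<lhd> J \<lhd> ?l) \<cdot> G ?II"
    by (simp add: lu2)
  also have "(J \<lhd> J \<lhd> ?l) \<cdot> G ?II = G U \<cdot> (J \<lhd> ?l)"
    using G_nat[of ?l] by simp
  finally have "(ku a U \<cdot> (J \<lhd> ?l)) \<cdot> (J \<lhd> ?l') = (ku a U \<cdot> (J \<lhd> ku a U) \<cdot> G U \<cdot> (J \<lhd> ?l)) \<cdot> (J \<lhd> ?l')"
    by simp
  moreover have "(J \<lhd> ?l) \<cdot> (J \<lhd> ?l') = id2 B (J \<otimes> U)"
    by (rule lwh_inv) (simp_all add: lu2)
  ultimately have "ku a U = ku a U \<cdot> (J \<lhd> ku a U) \<cdot> G U"
    by (simp del: lwh_vcomp)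
  then have "(J \<lhd> ku' a U) \<cdot> ku' a U \<cdot> ku a U = (J \<lhd> ku' a U) \<cdot> ku' a U \<cdot> ku a U \<cdot> (J \<lhd> ku a U) \<cdot> G U"
    by simp
  then have GU: "G U = J \<lhd> ku' a U"
    by (simp add: vcomp_chain[OF ku_inv(2)] lwh_invs)
  \<comment> \<open>The same unitor in \<open>ET_nat\<close>, with \<open>ET_comp\<close> and the
    value of \<open>G U\<close>, relates \<open>kt\<close> to \<open>ku'\<close>.\<close>
  have "ET ?I U \<cdot> (lu (?I \<otimes> J \<otimes> U) \<cdot> ass ?I ?I (J \<otimes> U)) = ET ?I U \<cdot> (lu ?I \<rhd> (J \<otimes> U))"
    by (simp add: lu2)
  also have "\<dots> = ET (?I \<otimes> ?I) U \<cdot> ((?I \<otimes> ?I) \<lhd> (?m \<rhd> U))"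
    using ET_nat[of "lu ?I" "?I \<otimes> ?I" ?I U] by simp
  also have "\<dots> = ET ?I U \<cdot> (?I \<lhd> ET ?I (J \<otimes> U)) \<cdot> (?I \<lhd> ?I \<lhd> G U) \<cdot> ass ?I ?I (J \<otimes> U)"
    by (simp add: ET_comp G_def ass_nat3s)
  also have "\<dots> = ET ?I U \<cdot> (?I \<lhd> ku' a U) \<cdot> (?I \<lhd> ET ?I U) \<cdot> ass ?I ?I (J \<otimes> U)"
    by (simp add: GU eva_nats)
  also have "\<dots> = kt a U \<cdot> ku' a U \<cdot> kt a U \<cdot> lu (J \<otimes> U) \<cdot> lu (?I \<otimes> J \<otimes> U) \<cdot> ass ?I ?I (J \<otimes> U)"
    by (simp add: ET_unit vcomp_chain[OF lu_nat])
  finally have "(ET ?I U \<cdot> lu (?I \<otimes> J \<otimes> U) \<cdot> ass ?I ?I (J \<otimes> U)) \<cdot> ass' ?I ?I (J \<otimes> U) \<cdot> lu' (?I \<otimes> J \<otimes> U) \<cdot> lu' (J \<otimes> U)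
      = (kt a U \<cdot> ku' a U \<cdot> kt a U \<cdot> lu (J \<otimes> U) \<cdot> lu (?I \<otimes> J \<otimes> U) \<cdot> ass ?I ?I (J \<otimes> U)) \<cdot> ass' ?I ?I (J \<otimes> U) \<cdot> lu' (?I \<otimes> J \<otimes> U) \<cdot> lu' (J \<otimes> U)"
    by simp
  then have "kt a U = kt a U \<cdot> ku' a U \<cdot> kt a U"
    by (simp add: ET_unit)
  \<comment> \<open>The idempotent is \<open>kt a U \<cdot> ku' a U\<close>; its inverse
    \<open>ku a U \<cdot> kt' a U\<close> is multiplied on the left.\<close>
  then have "ku a U \<cdot> kt' a U \<cdot> kt a U = ku a U \<cdot> kt' a U \<cdot> kt a U \<cdot> ku' a U \<cdot> kt a U"
    by simp
  then show ?thesis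
    by (simp add: vcomp_chain[OF kt_inv(2)] vcomp_chain[OF ku_inv(1)])
qed

text \<open>Naturality of \<open>lu\<close> and of \<open>enda p\<close> moves \<open>p\<close> out
  of the loop. What remains is \<open>kt a U \<cdot> ku' a U\<close>, the identity by
  \<open>kt_eq_ku\<close>.\<close>

lemma D_r_unit:
  assumes [simp]: "endo p a"
  shows "D_r B (I a) p = p"
proof (rule enda_faithful)
  show "endo (D_r B (I a) p) a" "endo p a" using D_r_enda(1)[of "I a" p] by simp_all
  fix U assume [simp]: "U \<in> Mor B" "trg B U = a"
  have "enda (D_r B (I a) p) U = kt a U \<cdot> (lu (J \<otimes> U) \<cdot> (I a \<lhd> enda p (J \<otimes> U))) \<cdot> lu' (J \<otimes> U) \<cdot> ku' a U"
    by (simp add: D_r_enda ET_unit CV_unit)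
  also have "lu (J \<otimes> U) \<cdot> (I a \<lhd> enda p (J \<otimes> U)) = enda p (J \<otimes> U) \<cdot> lu (J \<otimes> U)"
    by (simp add: lu_nat)
  also have "kt a U \<cdot> (enda p (J \<otimes> U) \<cdot> lu (J \<otimes> U)) \<cdot> lu' (J \<otimes> U) \<cdot> ku' a U = (kt a U \<cdot> enda p (J \<otimes> U)) \<cdot> ku' a U"
    by simp
  also have "kt a U \<cdot> enda p (J \<otimes> U) = enda p U \<cdot> kt a U"
    by (simp add: enda_nat)
  finally show "enda (D_r B (I a) p) U = enda p U"
    by (simp add: kt_eq_ku)
qed

lemma D_l_unit:
  assumes [simp]: "endo p a"
  shows "D_l B (I a) p = p"
proof (rule enda_faithful)
  show "endo (D_l B (I a) p) a" "endo p a" using D_l_enda(1)[of "I a" p] by simp_all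
  fix U assume [simp]: "U \<in> Mor B" "trg B U = a"
  have "enda (D_l B (I a) p) U = ku a U \<cdot> (J \<lhd> (lu U \<cdot> (enda p (I a \<otimes> U) \<cdot> lu' U))) \<cdot> kt' a U"
    by (simp add: D_l_enda EV_unit CT_unit)
  also have "lu U \<cdot> (enda p (I a \<otimes> U) \<cdot> lu' U) = enda p U"
    by (simp add: enda_nat)
  also have "ku a U \<cdot> (J \<lhd> enda p U) \<cdot> kt' a U = enda p U \<cdot> kt a U \<cdot> kt' a U"
    by (simp add: vcomp_chain[OF ku_nat] kt_eq_ku)
  finally show "enda (D_l B (I a) p) U = enda p U" by simp
qed

end

subsection \<open>Left dimensions as right dimensions\<close>

lemma mate_rwh:
  assumes "f \<in> Cell B" "dom2 B f = X" "cod2 B f = Y" "U \<in> Mor B" "trg B U = trg B X"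
  shows "mate B f \<rhd> U = EV Y (dg X \<otimes> U) \<cdot> (dg Y \<lhd> ((f \<rhd> (dg X \<otimes> U)) \<cdot> CV X U))"
proof -
  have t: "X \<in> Mor B" "Y \<in> Mor B" "src B Y = src B X" "trg B Y = trg B X"
    using assms cell_src_trg[of f] by auto
  note [simp] = assms t
  have [simp]: "coevt ((f \<rhd> dg X) \<cdot> coev B X) Y (dg X)"
    using coeva_postcomp1(1)[of "coev B X" X "dg X" f Y U] by simp
  show ?thesis
    by (simp add: mate_eq[OF assms(1-3)] transp_rwh coeva_postcomp1(2)[of "coev B X" X "dg X"])
qed

text \<open>Apply \<open>ET_nat\<close> to the cell \<open>ev B X\<close> from
  \<open>dg X \<otimes> X\<close> to the unit. On one side \<open>kt_eq_ku\<close> describes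
  \<open>ET\<close> of the unit; on the other \<open>ET_comp\<close> gives nested loops containing
  the mate of \<open>ev B X\<close>, which is essentially the coevaluation of
  \<open>dg X\<close>.\<close>

lemma EV_eq_ET_dag:
  assumes [simp]: "X \<in> Mor B" "U \<in> Mor B" "trg B U = src B X"
  shows "EV X U = ET (dg X) U \<cdot> (dg X \<lhd> (pv X \<rhd> U))"
proof -
  define a where "a = src B X"
  have [simp]: "a \<in> Obj B" "src B X = a" by (simp_all add: a_def)
  note [simp] = evtD(5-7)[OF ev_evt(1)[of X]]
  let ?I = "I a" and ?D = "dg X" and ?DD = "dg (dg X)"
  let ?Z = "?D \<otimes> X"
  let ?J = "dg ?I" and ?T = "dg ?Z \<otimes> U" and ?V = "?D \<otimes> ?DD \<otimes> U"
  let ?f = "dag_comp_iso B ?D X" and ?m = "mate B (ev B X)"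
  have [simp]: "?m \<in> Cell B" "dom2 B ?m = ?J" "cod2 B ?m = dg ?Z"
    using mate_type[of "ev B X" ?Z ?I] by simp_all
  let ?h = "(?f \<rhd> U) \<cdot> ass' ?D ?DD U"
  have e: "(ev B X \<rhd> W) \<cdot> ass' ?D X W = lu' W \<cdot> EV X W" if [simp]: "W \<in> Mor B" "trg B W = a" for W
    by (simp add: eva_def)
  \<comment> \<open>This composite enters \<open>?m\<close> through \<open>mate_rwh\<close>. The
    zigzag for \<open>X\<close> collapses it to the coevaluation of \<open>?D\<close>, up to the
    comparison \<open>?h\<close>.\<close>
  have "(ev B X \<rhd> ?T) \<cdot> CV ?Z U = ((ev B X \<rhd> ?T) \<cdot> (?Z \<lhd> ?h)) \<cdot> ass' ?D X ?V \<cdot> (?D \<lhd> CV X (?DD \<otimes> U)) \<cdot> CV ?D U"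
    by (simp add: CV_comp)
  also have "(ev B X \<rhd> ?T) \<cdot> (?Z \<lhd> ?h) = (?I \<lhd> ?h) \<cdot> (ev B X \<rhd> ?V)"
    by (subst interchange) simp_all
  also have "((?I \<lhd> ?h) \<cdot> (ev B X \<rhd> ?V)) \<cdot> ass' ?D X ?V \<cdot> (?D \<lhd> CV X (?DD \<otimes> U)) \<cdot> CV ?D U
      = (?I \<lhd> ?h) \<cdot> lu' ?V \<cdot> CV ?D U"
    by (simp add: vcomp_chain[OF e] adj_zz[OF adj_dag])
  also have "\<dots> = lu' ?T \<cdot> ?h \<cdot> CV ?D U"
    using lu'_nat'[of ?h ?V a] by (simp add: vcomp_chain flip: vcomp_assoc)
  finally have "?m \<rhd> U = ku a ?T \<cdot> (?J \<lhd> (?h \<cdot> CV ?D U))"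
    using mate_rwh[of "ev B X" ?Z ?I U] by (simp add: ku_def)
  also have "\<dots> = (?h \<cdot> CV ?D U) \<cdot> ku a U"
    by (subst ku_nat) simp_all
  finally have m: "?m \<rhd> U = ?h \<cdot> CV ?D U \<cdot> ku a U" by simp
  have hm: "ass ?D ?DD U \<cdot> (inv2 B ?f \<rhd> U) \<cdot> (?m \<rhd> U) = CV ?D U \<cdot> ku a U"
    unfolding m by (simp add: vcomp_chain[OF rwh_inv])
  \<comment> \<open>Since \<open>ET X\<close> is \<open>EV ?D\<close> precomposed with
    \<open>pv X\<close>, the zigzag for \<open>?D\<close> leaves exactly the pivotal cell.\<close>
  have pvX: "ET X (?DD \<otimes> U) \<cdot> (X \<lhd> CV ?D U) = pv X \<rhd> U"
    by (simp add: ET_eq interchanges adj_zz[OF adj_dag])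
  have "(EV X U \<cdot> (?D \<lhd> X \<lhd> ku a U)) \<cdot> ass ?D X (?J \<otimes> U) = ku a U \<cdot> EV X (?J \<otimes> U) \<cdot> ass ?D X (?J \<otimes> U)"
    by (simp add: eva_nats)
  also have "\<dots> = ET ?I U \<cdot> (ev B X \<rhd> (?J \<otimes> U))"
    by (simp add: ET_unit kt_eq_ku eva_def[of "ev B X"])
  also have "\<dots> = ET ?Z U \<cdot> (?Z \<lhd> (?m \<rhd> U))"
    using ET_nat[of "ev B X" ?Z ?I U] by simp
  also have "\<dots> = ET ?D U \<cdot> (?D \<lhd> ET X (?DD \<otimes> U)) \<cdot>
      (?D \<lhd> X \<lhd> (ass ?D ?DD U \<cdot> (inv2 B ?f \<rhd> U) \<cdot> (?m \<rhd> U))) \<cdot> ass ?D X (?J \<otimes> U)"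
    by (simp add: ET_comp ass_nat3s)
  also have "\<dots> = ET ?D U \<cdot> (?D \<lhd> (ET X (?DD \<otimes> U) \<cdot> (X \<lhd> CV ?D U))) \<cdot> (?D \<lhd> X \<lhd> ku a U) \<cdot> ass ?D X (?J \<otimes> U)"
    unfolding hm by simp
  also have "\<dots> = (ET ?D U \<cdot> (?D \<lhd> (pv X \<rhd> U)) \<cdot> (?D \<lhd> X \<lhd> ku a U)) \<cdot> ass ?D X (?J \<otimes> U)"
    unfolding pvX by simp
  finally have "((EV X U \<cdot> (?D \<lhd> X \<lhd> ku a U)) \<cdot> ass ?D X (?J \<otimes> U)) \<cdot> ass' ?D X (?J \<otimes> U) \<cdot> (?D \<lhd> X \<lhd> ku' a U)
      = ((ET ?D U \<cdot> (?D \<lhd> (pv X \<rhd> U)) \<cdot> (?D \<lhd> X \<lhd> ku a U)) \<cdot> ass ?D X (?J \<otimes> U)) \<cdot> ass' ?D X (?J \<otimes> U) \<cdot> (?D \<lhd> X \<lhd> ku' a U)"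
    by simp
  then show ?thesis by (simp add: lwh_invs)
qed

text \<open>Rewriting \<open>EV X\<close> by \<open>EV_eq_ET_dag\<close> and \<open>CT X\<close> by
  \<open>CT_eq\<close> puts \<open>pv X\<close> and \<open>pv' X\<close> around \<open>p\<close>;
  naturality of \<open>enda p\<close> cancels them and leaves the loop of
  \<open>dg X\<close>.\<close>

lemma D_l_eq_D_r_dag:
  assumes [simp]: "X \<in> Mor B" "endo p (trg B X)"
  shows "D_l B X p = D_r B (dg X) p"
proof (rule enda_faithful)
  show "endo (D_l B X p) (src B X)" "endo (D_r B (dg X) p) (src B X)"
    using D_l_enda(1)[of X p] D_r_enda(1)[of "dg X" p] by simp_all
  fix U assume [simp]: "U \<in> Mor B" "trg B U = src B X"
  have pp: "(pv X \<rhd> U) \<cdot> enda p (X \<otimes> U) \<cdot> (pv' X \<rhd> U) = enda p (dg (dg X) \<otimes> U)"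
    by (simp add: enda_nat vcomp_chain[OF rwh_inv])
  have "enda (D_l B X p) U
      = ET (dg X) U \<cdot> (dg X \<lhd> ((pv X \<rhd> U) \<cdot> enda p (X \<otimes> U) \<cdot> (pv' X \<rhd> U))) \<cdot> CV (dg X) U"
    by (simp add: D_l_enda EV_eq_ET_dag CT_eq)
  also have "\<dots> = enda (D_r B (dg X) p) U"
    unfolding pp by (simp add: D_r_enda)
  finally show "enda (D_l B X p) U = enda (D_r B (dg X) p) U" .
qed

lemma D_r_dag_dag:
  assumes "X \<in> Mor B" "endo p (src B X)"
  shows "D_r B (dg (dg X)) p = D_r B X p"
  using D_r_iso[of "pv X" X "dg (dg X)" "pv' X" p] assms by simp

text \<open>By \<open>D_r_iso\<close>, \<open>D_r\<close> cannot distinguish the dual of a composite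
  from the composite of the duals in reverse order, to which \<open>D_r_comp\<close>
  applies.\<close>

lemma D_r_dag_comp:
  assumes [simp]: "X \<in> Mor B" "Y \<in> Mor B" "src B Y = trg B X" "endo p (trg B Y)"
  shows "D_r B (dg (Y \<otimes> X)) p = D_r B (dg X) (D_r B (dg Y) p)"
  using D_r_iso[of "dag_comp_iso B Y X" "dg X \<otimes> dg Y" "dg (Y \<otimes> X)" "inv2 B (dag_comp_iso B Y X)" p]
  by (simp add: D_r_comp)

subsection \<open>Orbifold equivalence\<close>

lemma endo_id [simp]: "a \<in> Obj B \<Longrightarrow> endo (id2 B (I a)) a"
  by (simp add: endo_def)

lemma End_iff: "a \<in> Obj B \<Longrightarrow> p \<in> End B a \<longleftrightarrow> endo p a"
  by (auto simp: End_def hom2_def endo_def)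

text \<open>The domain of \<open>p\<close> is a unit 1-morphism, whose source recovers the
  object.\<close>

lemma endo_unique: "endo p a \<Longrightarrow> endo p b \<Longrightarrow> a = b"
  by (metis endoD(1,3) unit1_type(2))

section \<open>Quantum dimensions as values of \<open>D_r\<close>\<close>

lemma dim_r_eq:
  assumes [simp]: "X \<in> Mor B"
  shows "dim_r B X = D_r B X (id2 B (I (src B X)))"
proof -
  note [simp] = coevtD(5-7)[OF ev_evt(2)[of X]]
  show ?thesis by (simp add: dim_r_def D_r_def)
qed

lemma dim_l_eq:
  assumes [simp]: "X \<in> Mor B"
  shows "dim_l B X = D_l B X (id2 B (I (trg B X)))"
proof -
  note [simp] = coevtD(5-7)[OF tilde_evt(2)[of X]]
  show ?thesis by (simp add: dim_l_def D_l_def)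
qed

lemma dim_l_eq_dim_r_dag: "X \<in> Mor B \<Longrightarrow> dim_l B X = dim_r B (dg X)"
  by (simp add: dim_l_eq dim_r_eq D_l_eq_D_r_dag)

lemma is_qdim_iff: "is_qdim B p \<longleftrightarrow> (\<exists>Z \<in> Mor B. p = dim_r B Z)"
  unfolding is_qdim_def using dim_l_eq_dim_r_dag dag_type(1) by metis

lemma is_qdim_id:
  assumes [simp]: "a \<in> Obj B"
  shows "is_qdim B (id2 B (I a))"
proof -
  have "id2 B (I a) = dim_r B (I a)" by (simp add: dim_r_eq D_r_unit)
  then show ?thesis unfolding is_qdim_iff by (metis assms unit1_type(1))
qed

text \<open>Writing \<open>p\<close> as \<open>dim_r B Z\<close>, multiplicativity makes
  \<open>D_r B X p\<close> the right dimension of \<open>X \<otimes> Z\<close>.\<close>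

lemma is_qdim_D_r:
  assumes [simp]: "X \<in> Mor B" and p: "endo p (src B X)" "is_qdim B p"
  shows "is_qdim B (D_r B X p)"
proof -
  obtain Z where Z [simp]: "Z \<in> Mor B" and pZ: "p = dim_r B Z"
    using p(2) unfolding is_qdim_iff by blast
  \<comment> \<open>Composability of \<open>X\<close> with \<open>Z\<close> has to be derived:
    \<open>p\<close> is an endomorphism of the unit at \<open>src B X\<close> and also at
    \<open>trg B Z\<close>.\<close>
  have "endo (dim_r B Z) (trg B Z)" by (simp add: dim_r_eq D_r_enda)
  then have [simp]: "src B X = trg B Z" using endo_unique p(1) pZ by blast
  have "D_r B X p = dim_r B (X \<otimes> Z)" by (simp add: pZ dim_r_eq D_r_comp)
  then show ?thesis unfolding is_qdim_iff by (metis Z \<open>src B X = trg B Z\<close> assms(1) hcomp_type(1))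
qed

section \<open>Orbifold equivalence in terms of \<open>D_r\<close>, and its closure
  properties\<close>

lemma iso2_id: "X \<in> Mor B \<Longrightarrow> iso2 B (id2 B X)"
  by (rule iso2I[of _ "id2 B X"]) simp_all

text \<open>The \<open>D_r\<close> half of condition (ii). By \<open>D_l_eq_D_r_dag\<close> the
  \<open>D_l\<close> half for \<open>X\<close> is \<open>pres (dg X)\<close>.\<close>

definition pres :: "'m \<Rightarrow> bool" where
  "pres X \<longleftrightarrow> (\<forall>p. endo p (src B X) \<longrightarrow> iso2 B p \<longrightarrow> is_qdim B p \<longrightarrow> iso2 B (D_r B X p))"

text \<open>Condition (i) of orbifold equivalence is condition (ii) for the quantum dimension
  \<open>1 = dim_r I\<close>.\<close>

lemma orbifold_equivalent_iff:
  "orbifold_equivalent B a b \<longleftrightarrow>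
    (\<exists>X \<in> Mor B. src B X = a \<and> trg B X = b \<and> pres X \<and> pres (dg X))"
proof
  assume "orbifold_equivalent B a b"
  then obtain X where [simp]: "a \<in> Obj B" "b \<in> Obj B" and X: "X \<in> Mor B" "src B X = a" "trg B X = b"
    and r: "\<And>p. p \<in> End B a \<Longrightarrow> iso2 B p \<Longrightarrow> is_qdim B p \<Longrightarrow> iso2 B (D_r B X p)"
    and l: "\<And>p. p \<in> End B b \<Longrightarrow> iso2 B p \<Longrightarrow> is_qdim B p \<Longrightarrow> iso2 B (D_l B X p)"
    unfolding orbifold_equivalent_def hom_def by blast
  have "pres X" using X r by (auto simp: pres_def End_iff)
  moreover have "pres (dg X)"
    unfolding pres_def using X l D_l_eq_D_r_dag[OF X(1)] by (auto simp: End_iff)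
  ultimately show "\<exists>X \<in> Mor B. src B X = a \<and> trg B X = b \<and> pres X \<and> pres (dg X)" using X by blast
next
  assume "\<exists>X \<in> Mor B. src B X = a \<and> trg B X = b \<and> pres X \<and> pres (dg X)"
  then obtain X where X [simp]: "X \<in> Mor B" and a: "a = src B X" and b: "b = trg B X"
    and r: "pres X" and l: "pres (dg X)" by blast
  have "iso2 B (dim_r B X)"
    using r iso2_id is_qdim_id by (simp add: pres_def dim_r_eq)
  moreover have "iso2 B (dim_l B X)"
    using l iso2_id is_qdim_id by (simp add: pres_def dim_l_eq_dim_r_dag dim_r_eq)
  moreover have "iso2 B (D_r B X p)" if "endo p (src B X)" "iso2 B p" "is_qdim B p" for p
    using r that by (simp add: pres_def)
  moreover have "iso2 B (D_l B X p)" if "endo p (trg B X)" "iso2 B p" "is_qdim B p" for p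
    using l that by (simp add: pres_def D_l_eq_D_r_dag)
  ultimately show "orbifold_equivalent B a b"
    unfolding orbifold_equivalent_def a b by (intro conjI bexI[of _ X]) (auto simp: hom_def End_iff)
qed

text \<open>\<open>pres Y\<close> applies to \<open>D_r B X p\<close> because that element is again
  an invertible quantum dimension, by \<open>pres X\<close> and \<open>is_qdim_D_r\<close>.\<close>

lemma pres_comp:
  assumes [simp]: "X \<in> Mor B" "Y \<in> Mor B" "src B Y = trg B X" and p: "pres X" "pres Y"
  shows "pres (Y \<otimes> X)"
  unfolding pres_def
proof (intro allI impI)
  fix p assume "endo p (src B (Y \<otimes> X))" and i: "iso2 B p" "is_qdim B p"
  then have e [simp]: "endo p (src B X)" by simp
  have "iso2 B (D_r B X p)" "is_qdim B (D_r B X p)" "endo (D_r B X p) (src B Y)"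
    using p(1) i by (simp_all add: pres_def is_qdim_D_r D_r_enda)
  then show "iso2 B (D_r B (Y \<otimes> X) p)"
    using p(2) by (simp add: pres_def D_r_comp)
qed

lemma orbifold_equivalent_refl:
  assumes [simp]: "a \<in> Obj B"
  shows "orbifold_equivalent B a a"
proof -
  have "pres (I a)" by (simp add: pres_def D_r_unit)
  \<comment> \<open>\<open>D_r\<close> of the dual unit is \<open>D_l\<close> of the unit, hence the
    identity.\<close>
  moreover have "pres (dg (I a))"
    using D_l_eq_D_r_dag[of "I a"] by (simp add: pres_def D_l_unit)
  ultimately show ?thesis unfolding orbifold_equivalent_iff
    by (intro bexI[of _ "I a"]) simp_all
qed

text \<open>Passing to \<open>dg X\<close> exchanges the two \<open>pres\<close> conditions, since
  \<open>dg (dg X)\<close> is isomorphic to \<open>X\<close> through \<open>pv X\<close>.\<close>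

lemma orbifold_equivalent_sym:
  assumes "orbifold_equivalent B a b"
  shows "orbifold_equivalent B b a"
proof -
  obtain X where X [simp]: "X \<in> Mor B" and ab: "a = src B X" "b = trg B X" and p: "pres X" "pres (dg X)"
    using assms unfolding orbifold_equivalent_iff by blast
  have "pres (dg (dg X))" using p(1) by (simp add: pres_def D_r_dag_dag)
  then show ?thesis unfolding orbifold_equivalent_iff ab
    using p by (intro bexI[of _ "dg X"]) simp_all
qed

lemma orbifold_equivalent_trans:
  assumes "orbifold_equivalent B a b" "orbifold_equivalent B b c"
  shows "orbifold_equivalent B a c"
proof -
  obtain X where X [simp]: "X \<in> Mor B" "trg B X = b" and a: "a = src B X" and pX: "pres X" "pres (dg X)"
    using assms(1) unfolding orbifold_equivalent_iff by blast
  obtain Y where Y [simp]: "Y \<in> Mor B" "src B Y = b" and c: "c = trg B Y" and pY: "pres Y" "pres (dg Y)"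
    using assms(2) unfolding orbifold_equivalent_iff by blast
  have "pres (Y \<otimes> X)" using pX(1) pY(1) by (intro pres_comp) simp_all
  moreover have "pres (dg X \<otimes> dg Y)" using pX(2) pY(2) by (intro pres_comp) simp_all
  then have "pres (dg (Y \<otimes> X))" by (simp add: pres_def D_r_dag_comp D_r_comp)
  ultimately show ?thesis unfolding orbifold_equivalent_iff a c
    by (intro bexI[of _ "Y \<otimes> X"]) simp_all
qed

end

theorem theorem2p2:
  fixes B :: "('o, 'm, 'c) pbicat"
  assumes "pivotal_bicategory B"
  shows "equiv (Obj B) {(a, b). orbifold_equivalent B a b}"
proof -
  interpret pivotal_bicat B
    using assms by unfold_locales (auto simp: pivotal_bicategory_def)
  have "{(a, b). orbifold_equivalent B a b} \<subseteq> Obj B \<times> Obj B"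
    by (auto simp: orbifold_equivalent_def)
  then show ?thesis
    by (auto intro!: equivI refl_onI symI transI
      intro: orbifold_equivalent_refl orbifold_equivalent_sym orbifold_equivalent_trans)
qed

end
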